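(* Fix $D$ a nonsquare and nonzero integer congruent to $0$ or $1$ modulo $4$. Given two projective binary cubic forms $p_1$ and $p_2$ of discriminant $D$, their composition $P$ exists and is uniquely determined up to $SL_2(\mathbb Z)$-equivalence. Further this law of composition induces a group structure on the set of $SL_2(\mathbb Z)$-equivalence classes of projective binary cubic forms (of discriminant $D$) in which all nontrivial elements have order $3$.
   Context: A binary cubic form is a polynomial $p(x,y) = a_0x^3 + 3a_1x^2y + 3a_2xy^2 + a_3y^3$ with $a_0,a_1,a_2,a_3 \in \mathbb Z$. It is projective if $\gcd(a_1^2-a_0a_2,\ a_0a_3-a_1a_2,\ a_2^2-a_1a_3) = 1$, and it has discriminant $D$ if $D = a_0^2a_3^2 - 3a_1^2a_2^2 + 4a_1^3a_3 + 4a_0a_2^3 - 6a_0a_1a_2a_3$. The group $SL_2(\mathbb Z)$ acts on the right by $(f\cdot \gamma)(x,y) = f(px+qy, rx+sy)$ for $\gamma = \begin{pmatrix}p & q \\ r & s\end{pmatrix}$; this preserves discriminant and defines $SL_2(\mathbb Z)$-equivalence. For such $p$, define $p'(x,y) = c_0x^3 + 3c_1x^2y + 3c_2xy^2 + c_3y^3$ with $c_0 = \frac{1}{2}(2a_1^3-3a_0a_1a_2 + a_0^2a_3)$, $c_1 = \frac{1}{2}(a_1^2a_2-2a_0a_2^2 + a_0a_1a_3)$, $c_2 = -\frac{1}{2}(a_1a_2^2-2a_1^2a_3 + a_0a_2a_3)$, $c_3 = -\frac{1}{2}(2a_2^3-3a_1a_2a_3 + a_0a_3^2)$. For two projective binary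 cubic forms $p_1,p_2$ of discriminant $D$, their composition is defined to be any projective binary cubic form $P$ of discriminant $D$ such that $P(X,Y) = p_1'(x_1,y_1)p_2(x_2,y_2) + p_1(x_1,y_1)p_2'(x_2,y_2)$, where $X$ and $Y$ are integral linear combinations of $x_1x_2, x_1y_2, y_1x_2, y_1y_2$.
   Formalization: As literally defined, composition is not unique (P(x,-y) with (X,-Y) also works; fails for D=-23), so (X,Y) must be oriented: with X=s0x1x2+s1x1y2+…, Y=t0x1x2+t1x1y2+…, (s0t1-s1t0)(a1^2-a0a2)≥0, where a0,…,a3 are the coefficients of p1. *)

theory Defs
  imports Complex_Main "HOL-Algebra.Multiplicative_Group"
begin

text \<open>
  \<open>BCF a\<^sub>0 a\<^sub>1 a\<^sub>2 a\<^sub>3\<close> is the form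
  \<open>a\<^sub>0 x\<^sup>3 + 3 a\<^sub>1 x\<^sup>2 y + 3 a\<^sub>2 x y\<^sup>2 + a\<^sub>3 y\<^sup>3\<close>: the factors 3 are not part
  of the stored coefficients.
\<close>

datatype 'a bcf = BCF 'a 'a 'a 'a

fun bcf_eval :: "'a::comm_ring_1 bcf \<Rightarrow> 'a \<Rightarrow> 'a \<Rightarrow> 'a" where
  "bcf_eval (BCF a0 a1 a2 a3) x y = a0 * x^3 + 3 * a1 * x^2 * y + 3 * a2 * x * y^2 + a3 * y^3"

fun bcf_projective :: "int bcf \<Rightarrow> bool" where
  "bcf_projective (BCF a0 a1 a2 a3) \<longleftrightarrow>
     gcd (a1^2 - a0 * a2) (gcd (a0 * a3 - a1 * a2) (a2^2 - a1 * a3)) = 1"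

fun bcf_disc :: "int bcf \<Rightarrow> int" where
  "bcf_disc (BCF a0 a1 a2 a3) =
     a0^2 * a3^2 - 3 * a1^2 * a2^2 + 4 * a1^3 * a3 + 4 * a0 * a2^3 - 6 * a0 * a1 * a2 * a3"

definition proj_bcfs :: "int \<Rightarrow> int bcf set" where
  "proj_bcfs D = {f. bcf_projective f \<and> bcf_disc f = D}"

text \<open>
  Equality of forms is expressed as equality of their values at all integers; over the
  infinite domain of integers this is the same as equality of coefficients.
\<close>

definition sl2_equiv :: "int bcf \<Rightarrow> int bcf \<Rightarrow> bool" where
  "sl2_equiv f g \<longleftrightarrow> (\<exists>p q r s :: int. p * s - q * r = 1 \<and>
     (\<forall>x y. bcf_eval g x y = bcf_eval f (p * x + q * y) (r * x + s * y)))"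

definition sl2_class :: "int \<Rightarrow> int bcf \<Rightarrow> int bcf set" where
  "sl2_class D f = {g \<in> proj_bcfs D. sl2_equiv f g}"

definition sl2_classes :: "int \<Rightarrow> int bcf set set" where
  "sl2_classes D = sl2_class D ` proj_bcfs D"

abbreviation rat_bcf :: "int bcf \<Rightarrow> rat bcf" where
  "rat_bcf \<equiv> map_bcf rat_of_int"

fun bcf_prime :: "rat bcf \<Rightarrow> rat bcf" where
  "bcf_prime (BCF a0 a1 a2 a3) = BCF
     ((1/2) * (2 * a1^3 - 3 * a0 * a1 * a2 + a0^2 * a3))
     ((1/2) * (a1^2 * a2 - 2 * a0 * a2^2 + a0 * a1 * a3))
     (- (1/2) * (a1 * a2^2 - 2 * a1^2 * a3 + a0 * a2 * a3))
     (- (1/2) * (2 * a2^3 - 3 * a1 * a2 * a3 + a0 * a3^2))"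

type_synonym bil = "int \<times> int \<times> int \<times> int"

fun bil_eval :: "bil \<Rightarrow> rat \<Rightarrow> rat \<Rightarrow> rat \<Rightarrow> rat \<Rightarrow> rat" where
  "bil_eval (s0, s1, s2, s3) x1 y1 x2 y2 =
     of_int s0 * (x1 * x2) + of_int s1 * (x1 * y2) + of_int s2 * (y1 * x2) + of_int s3 * (y1 * y2)"

text \<open>
  The composition identity for \<open>X = S\<close> and \<open>Y = T\<close>, again with
  polynomials identified with the functions they define on the rationals.
\<close>

definition composed_via :: "int \<Rightarrow> int bcf \<Rightarrow> int bcf \<Rightarrow> int bcf \<Rightarrow> bil \<Rightarrow> bil \<Rightarrow> bool" where
  "composed_via D p1 p2 P S T \<longleftrightarrow> P \<in> proj_bcfs D \<and>
     (\<forall>x1 y1 x2 y2.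
        bcf_eval (rat_bcf P) (bil_eval S x1 y1 x2 y2) (bil_eval T x1 y1 x2 y2) =
          bcf_eval (bcf_prime (rat_bcf p1)) x1 y1 * bcf_eval (rat_bcf p2) x2 y2 +
          bcf_eval (rat_bcf p1) x1 y1 * bcf_eval (bcf_prime (rat_bcf p2)) x2 y2)"

text \<open>
  The identity alone cannot determine \<open>P\<close> up to \<open>SL\<^sub>2\<close>-equivalence: replacing \<open>Y\<close> by \<open>-Y\<close> and
  \<open>P(x, y)\<close> by \<open>P(x, -y)\<close> preserves it, while \<open>P(x, -y)\<close> represents the inverse class
  (lemma \<open>composed_via_not_unique\<close> is a concrete instance of the failure).
  As in Gauss's notion of direct composition (Disquisitiones Arithmeticae, art. 235), the
  sign is fixed by comparing the minor \<open>s\<^sub>0 t\<^sub>1 - s\<^sub>1 t\<^sub>0\<close>, which is the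
  determinant of \<open>(x\<^sub>2, y\<^sub>2) \<mapsto> (X, Y)\<close> at \<open>(x\<^sub>1, y\<^sub>1) = (1, 0)\<close>, with the leading
  coefficient \<open>a\<^sub>1\<^sup>2 - a\<^sub>0 a\<^sub>2\<close> of the Hessian of \<open>p\<^sub>1\<close>.
  The weak inequality makes this a pure normalisation: every \<open>P\<close> satisfying the identity,
  or else its mirror image, satisfies it (lemma \<open>composed_via_imp_composition\<close>).
\<close>

fun oriented :: "int bcf \<Rightarrow> bil \<Rightarrow> bil \<Rightarrow> bool" where
  "oriented (BCF a0 a1 a2 a3) (s0, s1, s2, s3) (t0, t1, t2, t3) \<longleftrightarrow>
     0 \<le> (s0 * t1 - s1 * t0) * (a1^2 - a0 * a2)"

definition is_composition :: "int \<Rightarrow> int bcf \<Rightarrow> int bcf \<Rightarrow> int bcf \<Rightarrow> bool" where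
  "is_composition D p1 p2 P \<longleftrightarrow> (\<exists>S T. composed_via D p1 p2 P S T \<and> oriented p1 S T)"

fun mirror :: "int bcf \<Rightarrow> int bcf" where
  "mirror (BCF a0 a1 a2 a3) = BCF a0 (- a1) a2 (- a3)"

lemma mirror_in_proj_bcfs: "P \<in> proj_bcfs D \<Longrightarrow> mirror P \<in> proj_bcfs D"
proof (cases P)
  case (BCF a0 a1 a2 a3)
  assume "P \<in> proj_bcfs D"
  moreover have "gcd (a1 * a2 - a0 * a3) z = gcd (a0 * a3 - a1 * a2) z" for z
    by (metis gcd_neg1_int minus_diff_eq)
  ultimately show ?thesis
    unfolding BCF proj_bcfs_def by simp
qed

lemma composed_via_mirror:
  assumes "composed_via D p1 p2 P S (t0, t1, t2, t3)"
  shows "composed_via D p1 p2 (mirror P) S (- t0, - t1, - t2, - t3)"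
proof -
  have neg: "bil_eval (- t0, - t1, - t2, - t3) x1 y1 x2 y2 = - bil_eval (t0, t1, t2, t3) x1 y1 x2 y2"
    for x1 y1 x2 y2 by simp
  have ev: "bcf_eval (rat_bcf (mirror P)) x (- y) = bcf_eval (rat_bcf P) x y" for x y
    by (cases P) simp
  show ?thesis
    using assms mirror_in_proj_bcfs unfolding composed_via_def neg ev by blast
qed

lemma composed_via_imp_composition:
  assumes "composed_via D p1 p2 P S T"
  shows "is_composition D p1 p2 P \<or> is_composition D p1 p2 (mirror P)"
proof -
  obtain a0 a1 a2 a3 where p1: "p1 = BCF a0 a1 a2 a3" by (cases p1)
  obtain s0 s1 s2 s3 where S: "S = (s0, s1, s2, s3)" by (cases S)
  obtain t0 t1 t2 t3 where T: "T = (t0, t1, t2, t3)" by (cases T)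
  have "oriented p1 S T \<or> oriented p1 S (- t0, - t1, - t2, - t3)"
  proof -
    have "(s0 * - t1 - s1 * - t0) * (a1^2 - a0 * a2) = - ((s0 * t1 - s1 * t0) * (a1^2 - a0 * a2))"
      by (simp add: algebra_simps)
    then show ?thesis unfolding p1 S T oriented.simps by linarith
  qed
  then show ?thesis
    using assms composed_via_mirror unfolding is_composition_def T by blast
qed

lemma composed_via_not_unique:
  defines "p \<equiv> BCF 0 1 1 (-5)" and "P \<equiv> BCF 1 1 (-1) (-2)"
  shows "p \<in> proj_bcfs (-23)" and "P \<in> proj_bcfs (-23)"
    and "composed_via (-23) p P P (1, 0, 0, -3) (0, 1, 2, 1)"
    and "composed_via (-23) p P (mirror P) (1, 0, 0, -3) (0, -1, -2, -1)"
    and "\<not> sl2_equiv P (mirror P)"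
proof -
  show "p \<in> proj_bcfs (-23)" and *: "P \<in> proj_bcfs (-23)"
    unfolding p_def P_def proj_bcfs_def by simp_all
  have "bcf_eval (rat_bcf P) (bil_eval (1, 0, 0, -3) x1 y1 x2 y2) (bil_eval (0, 1, 2, 1) x1 y1 x2 y2) =
          bcf_eval (bcf_prime (rat_bcf p)) x1 y1 * bcf_eval (rat_bcf P) x2 y2 +
          bcf_eval (rat_bcf p) x1 y1 * bcf_eval (bcf_prime (rat_bcf P)) x2 y2" for x1 y1 x2 y2
    unfolding p_def P_def by (simp add: field_simps power2_eq_square power3_eq_cube)
  with * show via: "composed_via (-23) p P P (1, 0, 0, -3) (0, 1, 2, 1)"
    unfolding composed_via_def by blast
  show "composed_via (-23) p P (mirror P) (1, 0, 0, -3) (0, -1, -2, -1)"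
    using composed_via_mirror[OF via] by simp
  show "\<not> sl2_equiv P (mirror P)"
  proof
    assume "sl2_equiv P (mirror P)"
    then obtain k l m n :: int where det: "k * n - l * m = 1"
      and ev: "\<And>x y. bcf_eval (mirror P) x y = bcf_eval P (k * x + l * y) (m * x + n * y)"
      unfolding sl2_equiv_def by blast
    define b1 where "b1 = k^2 * l + (k^2 * n + 2 * k * l * m) - (2 * k * m * n + l * m^2) - 2 * m^2 * n"
    define b2 where "b2 = k * l^2 + (l^2 * m + 2 * k * l * n) - (2 * l * m * n + k * n^2) - 2 * m * n^2"
    have b0: "k^3 + 3 * k^2 * m - 3 * k * m^2 - 2 * m^3 = 1"
      using ev[of 1 0] unfolding P_def by simp
    have b3: "l^3 + 3 * l^2 * n - 3 * l * n^2 - 2 * n^3 = 2"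
      using ev[of 0 1] unfolding P_def by simp
    have e1: "3 * b1 + 3 * b2 = - 6"
      using ev[of 1 1] b0 b3 unfolding P_def b1_def b2_def
      by (simp add: power2_eq_square power3_eq_cube algebra_simps)
    have e2: "3 * b2 - 3 * b1 = 0"
      using ev[of 1 "-1"] b0 b3 unfolding P_def b1_def b2_def
      by (simp add: power2_eq_square power3_eq_cube algebra_simps)
    have b1: "b1 = -1" and b2: "b2 = -1" using e1 e2 by linarith+
    have h0: "2 * k^2 + k * m + 3 * m^2 = 2"
    proof -
      have "b1^2 - (k^3 + 3 * k^2 * m - 3 * k * m^2 - 2 * m^3) * b2 =
              (2 * k^2 + k * m + 3 * m^2) * (k * n - l * m)^2"
        unfolding b1_def b2_def
        by (simp add: power2_eq_square power3_eq_cube algebra_simps)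
      then show ?thesis unfolding b0 b1 b2 det by simp
    qed
    have h1: "4 * k * l + (k * n + l * m) + 6 * m * n = - 1"
    proof -
      have "(k^3 + 3 * k^2 * m - 3 * k * m^2 - 2 * m^3) * (l^3 + 3 * l^2 * n - 3 * l * n^2 - 2 * n^3)
              - b1 * b2 = - (4 * k * l + (k * n + l * m) + 6 * m * n) * (k * n - l * m)^2"
        unfolding b1_def b2_def
        by (simp add: power2_eq_square power3_eq_cube algebra_simps)
      then show ?thesis unfolding b0 b1 b2 b3 det by simp
    qed
    have "m = 0"
    proof (rule ccontr)
      assume "m \<noteq> 0"
      then have "1 \<le> m^2" by (simp add: int_one_le_iff_zero_less)
      moreover have "(4 * k + m)^2 + 23 * m^2 = 16"
        using h0 by (simp add: power2_eq_square algebra_simps)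
      moreover have "0 \<le> (4 * k + m)^2" by simp
      ultimately show False by linarith
    qed
    then have "2 * (2 * (k * l)) = - 2" using h1 det by simp
    then show False by presburger
  qed
qed

end

theory Submission
  imports Defs "HOL-Library.Set_Algebras"
begin

text \<open>
  Put \<open>\<omega> = \<surd>D / 2\<close>. By the syzygy \<open>p'\<^sup>2 - (D/4) p\<^sup>2 = H\<^sup>3\<close> between a cubic form and its Hessian
  \<open>H\<close>, the form \<open>p' + p \<omega>\<close> over the quadratic field is a cube \<open>A (x + \<theta> y)\<^sup>3\<close>, so \<open>p\<close> is encoded by
  the lattice \<open>I = \<int> + \<int> \<theta>\<close> together with \<open>A\<close>; projectivity amounts to \<open>A I\<^sup>3\<close> being the quadratic order
  of discriminant \<open>D\<close>. Equivalence of forms is the relation \<open>(I, A) \<sim> (c I, A / c\<^sup>3)\<close>, and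
  \<open>P(X, Y) = p\<^sub>1' p\<^sub>2 + p\<^sub>1 p\<^sub>2'\<close> is the \<open>\<omega>\<close>-component of \<open>P' + P \<omega> = (p\<^sub>1' + p\<^sub>1 \<omega>)(p\<^sub>2' + p\<^sub>2 \<omega>)\<close>, which says
  that \<open>P\<close> belongs to \<open>(I\<^sub>1 I\<^sub>2, A\<^sub>1 A\<^sub>2)\<close>. That the \<open>\<omega>\<close>-component alone suffices follows by fixing \<open>(x\<^sub>1, y\<^sub>1)\<close>:
  covariance of the Hessian forces the determinant of \<open>(x\<^sub>2, y\<^sub>2) \<mapsto> (X, Y)\<close> to be \<open>\<plusminus> H\<^sub>1(x\<^sub>1, y\<^sub>1)\<close>, and the
  orientation condition selects the sign. Finally, \<open>(I, A)\<^sup>3 = (I\<^sup>3, A\<^sup>3) \<sim> (A I\<^sup>3, 1)\<close> is trivial.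
\<close>

section \<open>Covariants of binary cubic forms\<close>

fun hess0 :: "int bcf \<Rightarrow> int" where "hess0 (BCF a0 a1 a2 a3) = a1^2 - a0 * a2"
fun hess1 :: "int bcf \<Rightarrow> int" where "hess1 (BCF a0 a1 a2 a3) = a1 * a2 - a0 * a3"
fun hess2 :: "int bcf \<Rightarrow> int" where "hess2 (BCF a0 a1 a2 a3) = a2^2 - a1 * a3"

definition hess :: "int bcf \<Rightarrow> int \<Rightarrow> int \<Rightarrow> int" where
  "hess p x y = hess0 p * x^2 + hess1 p * x * y + hess2 p * y^2"

text \<open>Twice the form \<open>p'\<close>, whose coefficients need not be integers.\<close>

fun dprime :: "int bcf \<Rightarrow> int bcf" where
  "dprime (BCF a0 a1 a2 a3) = BCF
     (2 * a1^3 - 3 * a0 * a1 * a2 + a0^2 * a3)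
     (a1^2 * a2 - 2 * a0 * a2^2 + a0 * a1 * a3)
     (- (a1 * a2^2 - 2 * a1^2 * a3 + a0 * a2 * a3))
     (- (2 * a2^3 - 3 * a1 * a2 * a3 + a0 * a3^2))"

text \<open>The matrix may have any determinant: compositions substitute matrices that are not
  unimodular. The binomial factors 3 are divided out of the middle coefficients, as in the stored
  form.\<close>

fun bcf_subst :: "int bcf \<Rightarrow> int \<Rightarrow> int \<Rightarrow> int \<Rightarrow> int \<Rightarrow> int bcf" where
  "bcf_subst (BCF a0 a1 a2 a3) k l m n = BCF
     (a0 * k^3 + 3 * a1 * k^2 * m + 3 * a2 * k * m^2 + a3 * m^3)
     (a0 * k^2 * l + a1 * (k^2 * n + 2 * k * l * m) + a2 * (2 * k * m * n + l * m^2) + a3 * m^2 * n)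
     (a0 * k * l^2 + a1 * (l^2 * m + 2 * k * l * n) + a2 * (2 * l * m * n + k * n^2) + a3 * m * n^2)
     (a0 * l^3 + 3 * a1 * l^2 * n + 3 * a2 * l * n^2 + a3 * n^3)"

fun bcf_comb :: "int \<Rightarrow> int bcf \<Rightarrow> int \<Rightarrow> int bcf \<Rightarrow> int bcf" where
  "bcf_comb u (BCF a0 a1 a2 a3) v (BCF b0 b1 b2 b3) =
     BCF (u * a0 + v * b0) (u * a1 + v * b1) (u * a2 + v * b2) (u * a3 + v * b3)"

lemmas bcf_defs = bcf_eval.simps bcf_disc.simps hess0.simps hess1.simps hess2.simps hess_def
  dprime.simps bcf_subst.simps bcf_comb.simps bcf.inject

lemma bcf_eval_subst:
  "bcf_eval (bcf_subst p k l m n) x y = bcf_eval p (k * x + l * y) (m * x + n * y)"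
proof (cases p)
  case (BCF a0 a1 a2 a3)
  show ?thesis unfolding BCF bcf_defs by Groebner_Basis.algebra
qed

lemma bcf_eval_comb:
  "bcf_eval (bcf_comb u p v q) x y = u * bcf_eval p x y + v * bcf_eval q x y"
proof (cases p; cases q)
  fix a0 a1 a2 a3 b0 b1 b2 b3
  assume p: "p = BCF a0 a1 a2 a3" and q: "q = BCF b0 b1 b2 b3"
  show ?thesis unfolding p q bcf_defs by Groebner_Basis.algebra
qed

lemma bcf_disc_hess: "bcf_disc p = hess1 p ^ 2 - 4 * hess0 p * hess2 p"
proof (cases p)
  case (BCF a0 a1 a2 a3)
  show ?thesis unfolding BCF bcf_defs by Groebner_Basis.algebra
qed

lemma hess_subst:
  "hess0 (bcf_subst p k l m n) = (k * n - l * m)^2 * hess p k m"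
  "hess1 (bcf_subst p k l m n) = (k * n - l * m)^2 *
     (2 * hess0 p * k * l + hess1 p * (k * n + l * m) + 2 * hess2 p * m * n)"
  "hess2 (bcf_subst p k l m n) = (k * n - l * m)^2 * hess p l n"
proof (atomize (full), cases p)
  case (BCF a0 a1 a2 a3)
  show "hess0 (bcf_subst p k l m n) = (k * n - l * m)^2 * hess p k m \<and>
    hess1 (bcf_subst p k l m n) = (k * n - l * m)^2 *
     (2 * hess0 p * k * l + hess1 p * (k * n + l * m) + 2 * hess2 p * m * n) \<and>
    hess2 (bcf_subst p k l m n) = (k * n - l * m)^2 * hess p l n"
    unfolding BCF bcf_defs by (intro conjI; Groebner_Basis.algebra)
qed

lemma bcf_disc_subst: "bcf_disc (bcf_subst p k l m n) = (k * n - l * m)^6 * bcf_disc p"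
  unfolding bcf_disc_hess hess_subst unfolding hess_def by Groebner_Basis.algebra

text \<open>\<open>p'\<close> is a covariant of odd weight 3, so it sees the sign of the
  determinant. This later separates SL2 from GL2. The coefficient 0 makes \<open>bcf_comb\<close> a
  plain scaling.\<close>

lemma dprime_subst:
  "dprime (bcf_subst p k l m n) = bcf_comb ((k * n - l * m)^3) (bcf_subst (dprime p) k l m n) 0 p"
proof (cases p)
  case (BCF a0 a1 a2 a3)
  show ?thesis unfolding BCF bcf_defs by (intro conjI; Groebner_Basis.algebra)
qed

text \<open>With \<open>4 omega^2\<close> the discriminant of \<open>p\<close>, the form
  \<open>u p + v dprime p\<close> is the \<open>omega\<close>-component of
  \<open>(u + 2 v omega)(p' + p omega)\<close>. Multiplying the cube by a scalar keeps its root, so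
  the Hessian only scales, by the norm of that scalar.\<close>

lemma hess_comb_dprime:
  "hess0 (bcf_comb u p v (dprime p)) = (u^2 - bcf_disc p * v^2) * hess0 p"
  "hess1 (bcf_comb u p v (dprime p)) = (u^2 - bcf_disc p * v^2) * hess1 p"
  "hess2 (bcf_comb u p v (dprime p)) = (u^2 - bcf_disc p * v^2) * hess2 p"
proof (atomize (full), cases p)
  case (BCF a0 a1 a2 a3)
  show "hess0 (bcf_comb u p v (dprime p)) = (u^2 - bcf_disc p * v^2) * hess0 p \<and>
    hess1 (bcf_comb u p v (dprime p)) = (u^2 - bcf_disc p * v^2) * hess1 p \<and>
    hess2 (bcf_comb u p v (dprime p)) = (u^2 - bcf_disc p * v^2) * hess2 p"
    unfolding BCF bcf_defs by (intro conjI; Groebner_Basis.algebra)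
qed

lemma dprime_comb_dprime:
  "dprime (bcf_comb u p v (dprime p)) =
    bcf_comb ((u^2 - bcf_disc p * v^2) * (v * bcf_disc p)) p ((u^2 - bcf_disc p * v^2) * u) (dprime p)"
proof (cases p)
  case (BCF a0 a1 a2 a3)
  show ?thesis unfolding BCF bcf_defs by (intro conjI; Groebner_Basis.algebra)
qed

lemma bcf_syzygy:
  "bcf_eval (dprime p) x y ^ 2 - bcf_disc p * bcf_eval p x y ^ 2 = 4 * hess p x y ^ 3"
proof (cases p)
  case (BCF a0 a1 a2 a3)
  show ?thesis unfolding BCF bcf_defs by Groebner_Basis.algebra
qed

lemma hess_scale:
  "hess0 (bcf_comb c p 0 q) = c^2 * hess0 p"
  "hess1 (bcf_comb c p 0 q) = c^2 * hess1 p"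
  "hess2 (bcf_comb c p 0 q) = c^2 * hess2 p"
  by (cases p; cases q; simp add: power2_eq_square algebra_simps)+

lemma dprime_scale: "dprime (bcf_comb c p 0 q) = bcf_comb (c^3) (dprime p) 0 q"
  by (cases p; cases q; simp add: power2_eq_square power3_eq_cube algebra_simps)

section \<open>Projectivity as a Bezout identity\<close>

lemma gcd3_eq_1_iff:
  fixes a b c :: int
  shows "gcd a (gcd b c) = 1 \<longleftrightarrow> (\<exists>u v t. u * a + v * b + t * c = 1)"
proof
  assume g: "gcd a (gcd b c) = 1"
  obtain v t where vt: "v * b + t * c = gcd b c" using bezout_int by blast
  obtain u r where "u * a + r * gcd b c = gcd a (gcd b c)" using bezout_int by blast
  then have "u * a + r * (v * b + t * c) = 1" unfolding g vt .
  then have "u * a + (r * v) * b + (r * t) * c = 1" by (simp add: algebra_simps)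
  then show "\<exists>u v t. u * a + v * b + t * c = 1" by blast
next
  assume "\<exists>u v t. u * a + v * b + t * c = 1"
  then obtain u v t where "u * a + v * b + t * c = 1" by blast
  moreover have "gcd a (gcd b c) dvd u * a + v * b + t * c"
    by (intro dvd_add dvd_mult) (auto intro: dvd_trans[OF gcd_dvd2])
  ultimately show "gcd a (gcd b c) = 1" by simp
qed

text \<open>The three integers in \<open>bcf_projective\<close> are the Hessian coefficients up to
  the sign of the middle one, so projective means that the Hessian is primitive. The Bezout form
  later yields explicit members of spans.\<close>

lemma proj_bcfs_iff:
  "p \<in> proj_bcfs D \<longleftrightarrow>
     bcf_disc p = D \<and> (\<exists>u v t. u * hess0 p + v * hess1 p + t * hess2 p = 1)"
proof (cases p)
  case (BCF a0 a1 a2 a3)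
  have "gcd (a0 * a3 - a1 * a2) (hess2 p) = gcd (hess1 p) (hess2 p)"
    unfolding BCF hess1.simps by (metis gcd_neg1_int minus_diff_eq)
  then have "bcf_projective p \<longleftrightarrow> gcd (hess0 p) (gcd (hess1 p) (hess2 p)) = 1"
    unfolding BCF by simp
  then show ?thesis unfolding proj_bcfs_def gcd3_eq_1_iff by auto
qed

section \<open>Polynomial identities from integer values\<close>

text \<open>Sampling at 0, 1, -1, 2, -2 gives a Vandermonde system; elimination leaves the factors
  24 and 12, which cancel in characteristic 0. Degree 4 serves to compare squares of quadratic
  forms.\<close>

lemma quartic_coeffs_zero:
  fixes a b c d e :: "'a::{idom,ring_char_0}"
  assumes "\<And>y::int. a + b * of_int y + c * of_int y^2 + d * of_int y^3 + e * of_int y^4 = 0"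
  shows "a = 0" "b = 0" "c = 0" "d = 0" "e = 0"
proof -
  show a: "a = 0" using assms[of 0] by simp
  have e: "b + c + d + e = 0" "- b + c - d + e = 0"
    "2 * b + 4 * c + 8 * d + 16 * e = 0" "- 2 * b + 4 * c - 8 * d + 16 * e = 0"
    using assms[of 1] assms[of "-1"] assms[of 2] assms[of "-2"] a by (simp_all add: mult.commute)
  have "24 * e = 0" "12 * d = 0" "24 * c = 0" "12 * b = 0" using e by Groebner_Basis.algebra+
  then show "b = 0" "c = 0" "d = 0" "e = 0" by simp_all
qed

lemma cubic_coeffs_eq:
  fixes a b c d :: "'a::{idom,ring_char_0}"
  assumes "\<And>y::int. a + b * of_int y + c * of_int y^2 + d * of_int y^3 =
    a' + b' * of_int y + c' * of_int y^2 + d' * of_int y^3"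
  shows "a = a'" "b = b'" "c = c'" "d = d'"
proof -
  have "(a - a') + (b - b') * of_int y + (c - c') * of_int y^2 + (d - d') * of_int y^3
      + 0 * of_int y^4 = 0" for y
    using assms[of y] by Groebner_Basis.algebra
  from quartic_coeffs_zero[OF this] show "a = a'" "b = b'" "c = c'" "d = d'" by simp_all
qed

lemma bcf_eqI:
  fixes p q :: "int bcf"
  assumes "\<And>x y. bcf_eval p x y = bcf_eval q x y"
  shows "p = q"
proof (cases p; cases q)
  fix a0 a1 a2 a3 b0 b1 b2 b3
  assume p: "p = BCF a0 a1 a2 a3" and q: "q = BCF b0 b1 b2 b3"
  have "a0 + (3 * a1) * of_int y + (3 * a2) * of_int y^2 + a3 * of_int y^3 =
      b0 + (3 * b1) * of_int y + (3 * b2) * of_int y^2 + b3 * of_int y^3" for y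
    using assms[of 1 y] unfolding p q by simp
  from cubic_coeffs_eq[OF this] show ?thesis unfolding p q by simp
qed

lemma bcf_eval_of_int:
  "bcf_eval (map_bcf of_int p) (of_int x) (of_int y) = of_int (bcf_eval p x y)"
  by (cases p) simp

lemma sl2_equiv_iff_subst:
  "sl2_equiv p q \<longleftrightarrow> (\<exists>k l m n. k * n - l * m = 1 \<and> q = bcf_subst p k l m n)"
proof -
  have "(\<forall>x y. bcf_eval q x y = bcf_eval p (k * x + l * y) (m * x + n * y)) \<longleftrightarrow> q = bcf_subst p k l m n"
    for k l m n
    by (metis bcf_eqI bcf_eval_subst)
  then show ?thesis unfolding sl2_equiv_def by simp
qed

lemma int_square_if_rat_square:
  fixes r :: rat
  assumes "r^2 = of_int d"
  shows "\<exists>k. d = k^2"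
proof -
  obtain a b where r: "r = Fract a b" "b > 0" by (cases r) auto
  have "of_int (a^2) = (of_int (d * b^2) :: rat)"
    using assms r by (simp add: Fract_of_int_quotient power_divide field_simps)
  then have ab: "a^2 = d * b^2" by (simp only: of_int_eq_iff)
  then have "b^2 dvd a^2" by simp
  then have "b dvd a" by simp
  then obtain k where "a = b * k" ..
  with ab r(2) have "d = k^2" by (simp add: power_mult_distrib)
  then show ?thesis ..
qed

section \<open>The cube over the quadratic field\<close>

locale nonsquare_disc =
  fixes D :: int
  assumes nonsquare: "\<not> (\<exists>k. D = k^2)"
begin

text \<open>\<open>csqrt\<close> provides a root for either sign of \<open>D\<close>, so real and
  imaginary quadratic fields are treated together inside the complex numbers.\<close>

definition omega :: complex where "omega = csqrt (of_int D) / 2"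

lemma omega_square: "4 * omega^2 = of_int D"
  by (simp add: omega_def power_divide)

lemma omega_indep:
  assumes "of_rat u + of_rat v * omega = of_rat u' + of_rat v' * omega"
  shows "u = u'" "v = v'"
proof -
  show "v = v'"
  proof (rule ccontr)
    assume "v \<noteq> v'"
    define r where "r = (u' - u) / (v - v')"
    have "omega * of_rat (v - v') = of_rat (u' - u)"
      using assms by (simp add: of_rat_diff algebra_simps)
    then have "omega = of_rat r" using \<open>v \<noteq> v'\<close>
      by (simp add: r_def of_rat_divide field_simps)
    then have "(of_rat ((2 * r)^2) :: complex) = of_rat (of_int D)"
      using omega_square by (simp add: of_rat_power of_rat_mult power_mult_distrib)
    then have "(2 * r)^2 = of_int D" by (simp only: of_rat_eq_iff)
    then show False using int_square_if_rat_square nonsquare by blast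
  qed
  with assms show "u = u'" by simp
qed

lemma omega_indep_half:
  assumes "of_int u / 2 + of_int v * omega = of_int u' / 2 + of_int v' * omega"
  shows "u = u'" "v = v'"
proof -
  have "of_rat (of_int u / 2) + of_rat (of_int v) * omega = of_rat (of_int u' / 2) + of_rat (of_int v') * omega"
    using assms by (simp add: of_rat_divide)
  from omega_indep[OF this] show "u = u'" "v = v'" by simp_all
qed

text \<open>The Hessian has discriminant \<open>D\<close>. Completing the square at a zero with
  \<open>y\<close> nonzero would make \<open>D\<close> a rational, hence an integral,
  square.\<close>

lemma hess_anisotropic:
  assumes "bcf_disc p = D" "hess p x y = 0"
  shows "x = 0 \<and> y = 0"
proof -
  have y: "y = 0"
  proof (rule ccontr)
    assume y: "y \<noteq> 0"
    have "(2 * hess0 p * x + hess1 p * y)^2 = 4 * hess0 p * hess p x y + bcf_disc p * y^2"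
      unfolding bcf_disc_hess hess_def by Groebner_Basis.algebra
    then have "of_int ((2 * hess0 p * x + hess1 p * y)^2) = (of_int (D * y^2) :: rat)"
      using assms by simp
    then have "(of_int (2 * hess0 p * x + hess1 p * y) / of_int y :: rat)^2 = of_int D"
      using y by (simp add: power_divide)
    then show False using int_square_if_rat_square nonsquare by blast
  qed
  have "hess0 p \<noteq> 0" using assms(1) nonsquare unfolding bcf_disc_hess by auto
  with y assms(2) show ?thesis by (simp add: hess_def)
qed

lemma hess0_nonzero: "bcf_disc p = D \<Longrightarrow> hess0 p \<noteq> 0"
  using hess_anisotropic[of p 1 0] by (auto simp: hess_def)

definition cval :: "int bcf \<Rightarrow> complex \<Rightarrow> complex \<Rightarrow> complex" where
  "cval p x y = bcf_eval (map_bcf of_int (dprime p)) x y / 2 + bcf_eval (map_bcf of_int p) x y * omega"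

definition lead :: "int bcf \<Rightarrow> complex" where "lead p = cval p 1 0"

text \<open>For discriminant \<open>D\<close>, \<open>x + rt p y\<close> is a linear factor of the
  Hessian. The sign of \<open>omega\<close> selects the factor whose cube is proportional to
  \<open>p' + p omega\<close>, the conjugate one belonging to \<open>p' - p omega\<close>.\<close>

definition rt :: "int bcf \<Rightarrow> complex" where
  "rt p = (of_int (hess1 p) / 2 + omega) / of_int (hess0 p)"

lemma cval_of_int:
  "cval p (of_int x) (of_int y) = of_int (bcf_eval (dprime p) x y) / 2 + of_int (bcf_eval p x y) * omega"
  unfolding cval_def bcf_eval_of_int by simp

lemma hess0_rt:
  assumes "bcf_disc p = D"
  shows "2 * of_int (hess0 p) * rt p = of_int (hess1 p) + 2 * omega"
  using hess0_nonzero[OF assms] by (simp add: rt_def field_simps)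

lemma rt_root:
  assumes "bcf_disc p = D"
  shows "of_int (hess0 p) * rt p ^ 2 = of_int (hess1 p) * rt p - of_int (hess2 p)"
proof -
  have d: "4 * omega^2 = of_int (hess1 p) ^ 2 - 4 * of_int (hess0 p) * of_int (hess2 p)"
    using omega_square assms unfolding bcf_disc_hess by auto
  have "4 * of_int (hess0 p) * (of_int (hess0 p) * rt p ^ 2 - (of_int (hess1 p) * rt p - of_int (hess2 p))) = 0"
    using d hess0_rt[OF assms] by Groebner_Basis.algebra
  then show ?thesis using hess0_nonzero[OF assms] by simp
qed

text \<open>By the syzygy at (1, 0), the norm of \<open>lead p\<close> is
  \<open>hess0 p ^ 3\<close>.\<close>

lemma lead_nonzero:
  assumes "bcf_disc p = D"
  shows "lead p \<noteq> 0"
proof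
  assume 0: "lead p = 0"
  define u v where "u = bcf_eval (dprime p) 1 0" and "v = bcf_eval p 1 0"
  have "of_int u / 2 + of_int v * omega = 0"
    using 0 cval_of_int[of p 1 0] unfolding lead_def u_def v_def by simp
  then have "of_int u + 2 * of_int v * omega = 0" by (simp add: field_simps)
  then have "of_int u = - (2 * of_int v * omega)" by (simp only: eq_neg_iff_add_eq_0)
  then have "of_int u ^ 2 = 4 * omega^2 * of_int v ^ 2" by (simp add: power_mult_distrib)
  then have "of_int (u^2) = (of_int (D * v^2) :: complex)" unfolding omega_square by simp
  then have "u^2 - D * v^2 = 0" by (simp only: of_int_eq_iff)
  then have "hess p 1 0 = 0"
    using bcf_syzygy[of p 1 0] assms unfolding u_def v_def by simp
  then show False using hess_anisotropic[OF assms, of 1 0] by simp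
qed

lemma cval_cube:
  assumes "bcf_disc p = D"
  shows "cval p x y = lead p * (x + rt p * y)^3"
proof (cases p)
  case (BCF i0 i1 i2 i3)
  define a0 a1 a2 a3 where a: "a0 = complex_of_int i0" "a1 = complex_of_int i1"
    "a2 = complex_of_int i2" "a3 = complex_of_int i3"
  define h0 h1 where h: "h0 = a1^2 - a0 * a2" "h1 = a1 * a2 - a0 * a3"
  \<comment> \<open>Twice the coefficients of \<open>p' + p omega\<close> without binomial factors.
    The form is a cube because they are in geometric progression with ratio
    \<open>rt p\<close>.\<close>
  define f0 f1 f2 f3 where f: 
    "f0 = (2 * a1^3 - 3 * a0 * a1 * a2 + a0^2 * a3) + 2 * a0 * omega"
    "f1 = (a1^2 * a2 - 2 * a0 * a2^2 + a0 * a1 * a3) + 2 * a1 * omega"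
    "f2 = - (a1 * a2^2 - 2 * a1^2 * a3 + a0 * a2 * a3) + 2 * a2 * omega"
    "f3 = - (2 * a2^3 - 3 * a1 * a2 * a3 + a0 * a3^2) + 2 * a3 * omega"
  have W: "4 * omega^2 = a0^2 * a3^2 - 3 * a1^2 * a2^2 + 4 * a1^3 * a3 + 4 * a0 * a2^3 - 6 * a0 * a1 * a2 * a3"
    using omega_square assms unfolding BCF a by auto
  have h0: "h0 = of_int (hess0 p)" unfolding BCF a h by simp
  then have h0': "h0 \<noteq> 0" using hess0_nonzero[OF assms] by simp
  have r: "2 * h0 * rt p = h1 + 2 * omega"
    using hess0_rt[OF assms] unfolding h0[symmetric] unfolding BCF a h by simp
  have "2 * h0 * (f1 - f0 * rt p) = 0" "2 * h0 * (f2 - f1 * rt p) = 0" "2 * h0 * (f3 - f2 * rt p) = 0"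
    using r W unfolding f h by Groebner_Basis.algebra+
  then have "f1 = f0 * rt p" "f2 = f1 * rt p" "f3 = f2 * rt p" using h0' by auto
  moreover have "2 * cval p x y = f0 * x^3 + 3 * f1 * x^2 * y + 3 * f2 * x * y^2 + f3 * y^3"
    unfolding cval_def BCF f a by (simp add: field_simps)
  moreover have "2 * lead p = f0"
    unfolding lead_def cval_def BCF f a by (simp add: field_simps)
  ultimately have "2 * cval p x y = 2 * (lead p * (x + rt p * y)^3)"
    by Groebner_Basis.algebra
  then show ?thesis by simp
qed

end

section \<open>Lattices\<close>

text \<open>The complex numbers as a module over the integers. Lattices are its spans, and the
  product of two lattices is the span of their setwise product.\<close>

definition int_scale :: "int \<Rightarrow> complex \<Rightarrow> complex" where "int_scale n z = of_int n * z"

interpretation zm: Modules.module int_scale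
  by unfold_locales (simp_all add: int_scale_def algebra_simps)

text \<open>An inner span may be dropped under an outer one. Lattice products thereby inherit
  associativity and commutativity from setwise products.\<close>

lemma span_times_span: "zm.span (zm.span A * B) = zm.span (A * B)"
proof
  have "x * b \<in> zm.span (A * B)" if "x \<in> zm.span A" "b \<in> B" for x b
    using that(1)
  proof (induction rule: zm.span_induct_alt)
    case base
    show ?case by (simp add: zm.span_zero)
  next
    case (step n a y)
    have "a * b \<in> zm.span (A * B)" using step that by (auto intro: zm.span_base)
    then have "int_scale n (a * b) + y * b \<in> zm.span (A * B)"
      using step by (intro zm.span_add zm.span_scale)
    then show ?case by (simp only: int_scale_def[of n] distrib_right mult.assoc)
  qed
  then show "zm.span (zm.span A * B) \<subseteq> zm.span (A * B)"
    by (intro zm.span_minimal zm.subspace_span) (auto elim: set_times_elim)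
  show "zm.span (A * B) \<subseteq> zm.span (zm.span A * B)"
    by (intro zm.span_mono set_times_mono2 zm.span_superset subset_refl)
qed

lemma times_span: "zm.span (B * zm.span A) = zm.span (B * A)"
  using span_times_span[of A B] by (simp add: mult.commute)

lemma in_span_pair: "z \<in> zm.span {a, b} \<longleftrightarrow> (\<exists>m n. z = of_int m * a + of_int n * b)"
proof
  assume "z \<in> zm.span {a, b}"
  then obtain m n where "z - int_scale m a = int_scale n b"
    by (auto simp: zm.span_breakdown_eq[of z a] zm.span_singleton)
  then show "\<exists>m n. z = of_int m * a + of_int n * b"
    by (metis add.commute diff_eq_eq int_scale_def)
next
  assume "\<exists>m n. z = of_int m * a + of_int n * b"
  then obtain m n where "z = int_scale m a + int_scale n b" unfolding int_scale_def by blast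
  moreover have "a \<in> zm.span {a, b}" "b \<in> zm.span {a, b}" by (auto intro: zm.span_base)
  ultimately show "z \<in> zm.span {a, b}" by (simp add: zm.span_add zm.span_scale)
qed

lemma zspan_eqI:
  assumes "A \<subseteq> zm.span B" "B \<subseteq> zm.span A"
  shows "zm.span A = zm.span B"
  using assms zm.span_eq by blast

lemma singleton_times: "{a} * {b} = {a * b :: complex}"
  by (auto simp: set_times_def)

lemma one_times_set: "{1 :: complex} * A = A"
  by (auto simp: set_times_def)

section \<open>Lattices attached to forms, their homotheties and products\<close>

context nonsquare_disc
begin

definition lat :: "int bcf \<Rightarrow> complex set" where "lat p = zm.span {1, rt p}"

text \<open>Homothety is written as a product with a singleton, so scalars move by the same laws as
  lattices. The scalar is nonzero as soon as \<open>lead p\<close> is.\<close>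

definition lat_equiv :: "int bcf \<Rightarrow> int bcf \<Rightarrow> bool" where
  "lat_equiv p q \<longleftrightarrow> (\<exists>c. lat q = zm.span ({c} * lat p) \<and> lead q * c^3 = lead p)"

definition lat_comp :: "int bcf \<Rightarrow> int bcf \<Rightarrow> int bcf \<Rightarrow> bool" where
  "lat_comp p1 p2 P \<longleftrightarrow>
     (\<exists>c. lat P = zm.span ({c} * (lat p1 * lat p2)) \<and> lead P * c^3 = lead p1 * lead p2)"

lemma in_lat: "z \<in> lat p \<longleftrightarrow> (\<exists>m n. z = of_int m + of_int n * rt p)"
  by (simp add: lat_def in_span_pair)

lemma lat_equiv_sym:
  assumes "bcf_disc p = D" "lat_equiv p q"
  shows "lat_equiv q p"
proof -
  obtain c where c: "lat q = zm.span ({c} * lat p)" "lead q * c^3 = lead p"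
    using assms(2) unfolding lat_equiv_def by blast
  have "c \<noteq> 0" using c(2) lead_nonzero[OF assms(1)] by auto
  then have "{1 / c} * ({c} * lat p) = lat p"
    by (simp add: mult.assoc[symmetric] singleton_times one_times_set)
  then have "zm.span ({1 / c} * lat q) = zm.span (lat p)" unfolding c(1) times_span by simp
  also have "\<dots> = lat p" unfolding lat_def by simp
  finally show ?thesis
    unfolding lat_equiv_def using c(2) \<open>c \<noteq> 0\<close>
    by (intro exI[of _ "1 / c"]) (simp add: power_divide field_simps)
qed

lemma lat_comp_unique:
  assumes "bcf_disc p1 = D" "bcf_disc p2 = D" "lat_comp p1 p2 P" "lat_comp p1 p2 Q"
  shows "lat_equiv P Q"
proof -
  obtain c d where c: "lat P = zm.span ({c} * (lat p1 * lat p2))" "lead P * c^3 = lead p1 * lead p2"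
    and d: "lat Q = zm.span ({d} * (lat p1 * lat p2))" "lead Q * d^3 = lead p1 * lead p2"
    using assms unfolding lat_comp_def by blast
  have "c \<noteq> 0" using c(2) lead_nonzero assms by fastforce
  have "zm.span ({d / c} * lat P) = zm.span (({d / c} * {c}) * (lat p1 * lat p2))"
    unfolding c(1) times_span by (simp only: mult.assoc)
  then have "lat Q = zm.span ({d / c} * lat P)"
    unfolding d(1) using \<open>c \<noteq> 0\<close> by (simp add: singleton_times)
  moreover have "lead Q * (d / c)^3 = lead P"
    using c(2) d(2) \<open>c \<noteq> 0\<close> by (simp add: power_divide field_simps)
  ultimately show ?thesis unfolding lat_equiv_def by blast
qed

lemma lat_comp_cong:
  assumes "bcf_disc p1 = D" "bcf_disc p2 = D"
    and "lat_equiv p1 q1" "lat_equiv p2 q2" "lat_equiv P Q" "lat_comp p1 p2 P"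
  shows "lat_comp q1 q2 Q"
proof -
  obtain c where c: "lat P = zm.span ({c} * (lat p1 * lat p2))" "lead P * c^3 = lead p1 * lead p2"
    using assms unfolding lat_comp_def by blast
  obtain k where k: "lat Q = zm.span ({k} * lat P)" "lead Q * k^3 = lead P"
    using assms unfolding lat_equiv_def by blast
  obtain a where a: "lat p1 = zm.span ({a} * lat q1)" "lead p1 * a^3 = lead q1"
    using lat_equiv_sym assms unfolding lat_equiv_def by blast
  obtain b where b: "lat p2 = zm.span ({b} * lat q2)" "lead p2 * b^3 = lead q2"
    using lat_equiv_sym assms unfolding lat_equiv_def by blast
  have "lat Q = zm.span ({k} * ({c} * (lat p1 * lat p2)))" unfolding k(1) c(1) times_span ..
  also have "\<dots> = zm.span (({k} * {c} * lat p2) * lat p1)" by (simp only: ac_simps)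
  also have "\<dots> = zm.span (({k} * {c} * ({a} * lat q1)) * lat p2)"
    unfolding a(1) times_span by (simp only: ac_simps)
  also have "\<dots> = zm.span ({k} * {c} * {a} * {b} * (lat q1 * lat q2))"
    unfolding b(1) times_span by (simp only: ac_simps)
  finally have "lat Q = zm.span ({k * c * a * b} * (lat q1 * lat q2))"
    by (simp only: singleton_times)
  moreover have "lead Q * (k * c * a * b)^3 = lead q1 * lead q2"
    using c(2) k(2) a(2) b(2) by (simp add: power_mult_distrib) Groebner_Basis.algebra
  ultimately show ?thesis unfolding lat_comp_def by blast
qed

text \<open>Both bracketings give the triple product of lattices up to a scalar: \<open>u\<close>
  contributes \<open>c\<close>, \<open>x\<close> contributes \<open>d\<close>, and passing to
  \<open>v\<close> divides by \<open>e\<close>.\<close>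

lemma lat_comp_assoc:
  assumes "bcf_disc p2 = D" "bcf_disc p3 = D"
    and "lat_comp p1 p2 u" "lat_comp u p3 x" "lat_comp p2 p3 v"
  shows "lat_comp p1 v x"
proof -
  obtain c where c: "lat u = zm.span ({c} * (lat p1 * lat p2))" "lead u * c^3 = lead p1 * lead p2"
    using assms unfolding lat_comp_def by blast
  obtain d where d: "lat x = zm.span ({d} * (lat u * lat p3))" "lead x * d^3 = lead u * lead p3"
    using assms unfolding lat_comp_def by blast
  obtain e where e: "lat v = zm.span ({e} * (lat p2 * lat p3))" "lead v * e^3 = lead p2 * lead p3"
    using assms unfolding lat_comp_def by blast
  have "e \<noteq> 0" using e(2) lead_nonzero assms by fastforce
  have "lat x = zm.span (({d} * lat p3) * lat u)" unfolding d(1) by (simp only: ac_simps)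
  also have "\<dots> = zm.span ({d} * {c} * lat p1 * (lat p2 * lat p3))"
    unfolding c(1) times_span by (simp only: ac_simps)
  also have "{d} * {c} = {d * c / e} * {e}" using \<open>e \<noteq> 0\<close> by (simp add: singleton_times)
  also have "zm.span ({d * c / e} * {e} * lat p1 * (lat p2 * lat p3)) =
      zm.span ({d * c / e} * (lat p1 * lat v))"
    unfolding e(1) mult.assoc[symmetric] times_span by (simp only: ac_simps)
  finally have "lat x = zm.span ({d * c / e} * (lat p1 * lat v))" .
  moreover have "lead x * (d * c / e)^3 = lead p1 * lead v"
  proof -
    have "lead x * (d * c)^3 = lead p1 * lead v * e^3"
      unfolding power_mult_distrib using c(2) d(2) e(2) by Groebner_Basis.algebra
    then show ?thesis using \<open>e \<noteq> 0\<close> by (simp add: power_divide field_simps)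
  qed
  ultimately show ?thesis unfolding lat_comp_def by blast
qed

section \<open>Classes of forms as classes of lattices\<close>

text \<open>The substitution turns \<open>x + rt p y\<close> into \<open>e x + f y\<close>.
  Unimodularity makes \<open>e\<close>, \<open>f\<close> another basis of \<open>lat p\<close>, and
  division by \<open>e\<close> normalises it to \<open>1\<close>, \<open>rt q\<close>.\<close>

lemma sl2_equiv_imp_lat_equiv:
  assumes "bcf_disc p = D" "bcf_disc q = D" "sl2_equiv p q"
  shows "lat_equiv p q"
proof -
  obtain k l m n where det: "k * n - l * m = 1" and q: "q = bcf_subst p k l m n"
    using assms(3) unfolding sl2_equiv_iff_subst by blast
  define e f where "e = of_int k + of_int m * rt p" and "f = of_int l + of_int n * rt p"
  have "bcf_eval (dprime q) x y = bcf_eval (dprime p) (k * x + l * y) (m * x + n * y)" for x y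
    unfolding q dprime_subst det bcf_eval_comb bcf_eval_subst by simp
  then have cv: "cval q (of_int x) (of_int y) =
      cval p (of_int (k * x + l * y)) (of_int (m * x + n * y))" for x y
    unfolding cval_of_int unfolding q bcf_eval_subst by simp
  have "lead q + (3 * lead q * rt q) * of_int y + (3 * lead q * rt q ^ 2) * of_int y^2
      + (lead q * rt q^3) * of_int y^3
     = lead p * e^3 + (3 * lead p * e^2 * f) * of_int y + (3 * lead p * e * f^2) * of_int y^2
      + (lead p * f^3) * of_int y^3" for y
  proof -
    have "lead q * (1 + rt q * of_int y)^3 = lead p * (e + f * of_int y)^3"
      using cv[of 1 y] unfolding cval_cube[OF assms(1)] cval_cube[OF assms(2)] e_def f_def
      by (simp add: algebra_simps)
    then show ?thesis by Groebner_Basis.algebra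
  qed
  \<comment> \<open>Equal cubes do not determine the linear forms separately from their leading
    constants; the first two coefficients still give the ratio \<open>rt q = f / e\<close>.\<close>
  from cubic_coeffs_eq(1,2)[OF this]
  have 1: "lead q = lead p * e^3" and 2: "lead q * rt q = lead p * e^2 * f" by simp_all
  have "e \<noteq> 0" using 1 lead_nonzero[OF assms(2)] by auto
  have "lead p * e^2 * (e * rt q) = lead p * e^2 * f"
    using 1 2 by Groebner_Basis.algebra
  then have ef: "e * rt q = f" using \<open>e \<noteq> 0\<close> lead_nonzero[OF assms(1)] by simp
  have det': "of_int k * of_int n - of_int l * of_int m = (1::complex)"
    using det by (metis of_int_1 of_int_diff of_int_mult)
  have "zm.span {1, rt p} = zm.span {e, f}"
  proof (rule zspan_eqI)
    have "1 = of_int n * e + of_int (- m) * f" "rt p = of_int (- l) * e + of_int k * f"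
      unfolding e_def f_def of_int_minus using det' by Groebner_Basis.algebra+
    then show "{1, rt p} \<subseteq> zm.span {e, f}"
      by (metis in_span_pair insert_subset empty_subsetI)
    show "{e, f} \<subseteq> zm.span {1, rt p}"
      using in_lat[of e p] in_lat[of f p] unfolding e_def f_def lat_def by blast
  qed
  then have "zm.span ({1 / e} * lat p) = zm.span ({1 / e} * {e, f})"
    unfolding lat_def by (metis times_span)
  also have "{1 / e} * {e, f} = {1, rt q}" using \<open>e \<noteq> 0\<close> unfolding ef[symmetric] by (auto simp: set_times_def)
  finally have "lat q = zm.span ({1 / e} * lat p)" unfolding lat_def ..
  moreover have "lead q * (1 / e)^3 = lead p" using 1 \<open>e \<noteq> 0\<close> by (simp add: power_divide)
  ultimately show ?thesis unfolding lat_equiv_def by blast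
qed

text \<open>Needed to exclude determinant -1, under which \<open>dprime p\<close> would equal its
  own negative.\<close>

lemma dprime_nonzero:
  assumes "bcf_disc p = D"
  shows "dprime p \<noteq> BCF 0 0 0 0"
proof
  assume 0: "dprime p = BCF 0 0 0 0"
  obtain a0 a1 a2 a3 where p: "p = BCF a0 a1 a2 a3" by (cases p)
  have "2 * hess0 p ^ 2 = a1 * (2 * a1^3 - 3 * a0 * a1 * a2 + a0^2 * a3) - a0 * (a1^2 * a2 - 2 * a0 * a2^2 + a0 * a1 * a3)"
    unfolding p bcf_defs by Groebner_Basis.algebra
  also have "\<dots> = 0" using 0 unfolding p by simp
  finally show False using hess0_nonzero[OF assms] by simp
qed

text \<open>Writing \<open>c\<close> and \<open>c rt p\<close> in the basis of \<open>lat q\<close>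
  gives an integral matrix carrying \<open>q\<close> to \<open>p\<close> in both components.
  Discriminants force determinant 1 or -1, and the weight of \<open>p'\<close> rules out -1.\<close>

lemma lat_equiv_imp_sl2_equiv:
  assumes p: "bcf_disc p = D" and q: "bcf_disc q = D" and "lat_equiv p q"
  shows "sl2_equiv q p"
proof -
  obtain c where c: "lat q = zm.span ({c} * lat p)" "lead q * c^3 = lead p"
    using assms(3) unfolding lat_equiv_def by blast
  have "1 \<in> lat p" "rt p \<in> lat p" unfolding lat_def by (auto intro: zm.span_base)
  then have "c * 1 \<in> {c} * lat p" "c * rt p \<in> {c} * lat p" by (blast intro: set_times_intro)+
  then have "c \<in> lat q" "c * rt p \<in> lat q" unfolding c(1) by (auto intro: zm.span_base)
  then obtain k l m n where km: "c = of_int k + of_int m * rt q" and ln: "c * rt p = of_int l + of_int n * rt q"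
    unfolding in_lat by blast
  have "cval p (of_int x) (of_int y) = cval q (of_int (k * x + l * y)) (of_int (m * x + n * y))" for x y
  proof -
    have "c * (of_int x + rt p * of_int y) = of_int (k * x + l * y) + rt q * of_int (m * x + n * y)"
      unfolding of_int_add of_int_mult using km ln by Groebner_Basis.algebra
    then show ?thesis
      unfolding cval_cube[OF p] cval_cube[OF q] c(2)[symmetric] by (metis mult.assoc power_mult_distrib)
  qed
  then have "of_int (bcf_eval (dprime p) x y) / 2 + of_int (bcf_eval p x y) * omega =
     of_int (bcf_eval (dprime q) (k * x + l * y) (m * x + n * y)) / 2
      + of_int (bcf_eval q (k * x + l * y) (m * x + n * y)) * omega" for x y
    unfolding cval_of_int .
  then have "bcf_eval (dprime p) x y = bcf_eval (dprime q) (k * x + l * y) (m * x + n * y)"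
    "bcf_eval p x y = bcf_eval q (k * x + l * y) (m * x + n * y)" for x y
    using omega_indep_half by blast+
  then have dp: "dprime p = bcf_subst (dprime q) k l m n" and sub: "p = bcf_subst q k l m n"
    by (auto intro!: bcf_eqI simp: bcf_eval_subst)
  define d where "d = k * n - l * m"
  have "D = d^6 * D" using bcf_disc_subst[of q k l m n] p q sub unfolding d_def by simp
  moreover have "D \<noteq> 0" using nonsquare by auto
  ultimately have "d^6 = 1" by simp
  moreover have "d dvd d^6" by simp
  ultimately have "d = 1 \<or> d = -1" by auto
  moreover have "d \<noteq> -1"
  proof
    assume d: "d = -1"
    have "dprime p = bcf_comb (d^3) (dprime p) 0 q"
      using dprime_subst[of q k l m n] unfolding sub[symmetric] dp[symmetric] d_def .
    then have "dprime p = BCF 0 0 0 0" unfolding d by (cases "dprime p"; cases q) auto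
    then show False using dprime_nonzero[OF p] by simp
  qed
  ultimately show ?thesis unfolding sl2_equiv_iff_subst using sub d_def by auto
qed

end

section \<open>Compositions are products of lattices\<close>

text \<open>In the application \<open>u\<close>, \<open>v\<close>, \<open>h\<close> are the values
  of \<open>dprime p1\<close>, \<open>p1\<close> and the Hessian of \<open>p1\<close> at a fixed
  point, and \<open>p\<close> is \<open>p2\<close>. Taking covariants of both sides first controls
  the determinant and then recovers the \<open>dprime\<close> component.\<close>

lemma pencil_covariants:
  assumes eq: "bcf_comb 2 (bcf_subst P k l m n) 0 P = bcf_comb u p v (dprime p)"
    and h: "u^2 - bcf_disc p * v^2 = 4 * h^3"
  shows "(k * n - l * m)^2 * hess P k m = h^3 * hess0 p"
    and "(k * n - l * m)^2 *
      (2 * hess0 P * k * l + hess1 P * (k * n + l * m) + 2 * hess2 P * m * n) = h^3 * hess1 p"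
    and "(k * n - l * m)^2 * hess P l n = h^3 * hess2 p"
    and "(k * n - l * m)^6 * bcf_disc P = h^6 * bcf_disc p"
    and "2 * (k * n - l * m)^3 * bcf_eval (dprime P) (k * x + l * y) (m * x + n * y) =
      h^3 * (v * bcf_disc p * bcf_eval p x y + u * bcf_eval (dprime p) x y)"
proof -
  show 0: "(k * n - l * m)^2 * hess P k m = h^3 * hess0 p"
    using arg_cong[OF eq, of hess0] unfolding hess_scale hess_comb_dprime hess_subst h by simp
  show 1: "(k * n - l * m)^2 *
      (2 * hess0 P * k * l + hess1 P * (k * n + l * m) + 2 * hess2 P * m * n) = h^3 * hess1 p"
    using arg_cong[OF eq, of hess1] unfolding hess_scale hess_comb_dprime hess_subst h by simp
  show 2: "(k * n - l * m)^2 * hess P l n = h^3 * hess2 p"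
    using arg_cong[OF eq, of hess2] unfolding hess_scale hess_comb_dprime hess_subst h by simp
  have "(k * n - l * m)^6 * bcf_disc P = bcf_disc (bcf_subst P k l m n)"
    by (simp add: bcf_disc_subst)
  also have "\<dots> = (h^3 * hess1 p)^2 - 4 * (h^3 * hess0 p) * (h^3 * hess2 p)"
    unfolding bcf_disc_hess hess_subst 0 1 2 ..
  also have "\<dots> = h^6 * bcf_disc p" unfolding bcf_disc_hess by Groebner_Basis.algebra
  finally show "(k * n - l * m)^6 * bcf_disc P = h^6 * bcf_disc p" .
  have "bcf_eval (dprime (bcf_comb 2 (bcf_subst P k l m n) 0 P)) x y =
      bcf_eval (dprime (bcf_comb u p v (dprime p))) x y"
    unfolding eq ..
  then show "2 * (k * n - l * m)^3 * bcf_eval (dprime P) (k * x + l * y) (m * x + n * y) =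
      h^3 * (v * bcf_disc p * bcf_eval p x y + u * bcf_eval (dprime p) x y)"
    unfolding dprime_scale dprime_comb_dprime dprime_subst bcf_eval_comb bcf_eval_subst h
    by (simp add: algebra_simps)
qed

section \<open>The composition identity over the integers\<close>

text \<open>Grouped by \<open>x2\<close>, \<open>y2\<close>: for fixed \<open>x1\<close>,
  \<open>y1\<close> it is a row of a linear substitution, as \<open>bcf_subst\<close>
  expects.\<close>

definition ibil :: "bil \<Rightarrow> int \<Rightarrow> int \<Rightarrow> int \<Rightarrow> int \<Rightarrow> int" where
  "ibil S x1 y1 x2 y2 =
     (case S of (s0, s1, s2, s3) \<Rightarrow> (s0 * x1 + s2 * y1) * x2 + (s1 * x1 + s3 * y1) * y2)"

lemma bil_eval_of_int:
  "bil_eval S (of_int x1) (of_int y1) (of_int x2) (of_int y2) = of_int (ibil S x1 y1 x2 y2)"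
  by (cases S) (simp add: ibil_def algebra_simps)

lemma bcf_prime_eq_dprime:
  "bcf_eval (bcf_prime (rat_bcf p)) x y = bcf_eval (rat_bcf (dprime p)) x y / 2"
  by (cases p) (simp add: field_simps)

lemma composition_identity_int:
  assumes "\<And>x1 y1 x2 y2.
    bcf_eval (rat_bcf P) (bil_eval S x1 y1 x2 y2) (bil_eval T x1 y1 x2 y2) =
      bcf_eval (bcf_prime (rat_bcf p1)) x1 y1 * bcf_eval (rat_bcf p2) x2 y2 +
      bcf_eval (rat_bcf p1) x1 y1 * bcf_eval (bcf_prime (rat_bcf p2)) x2 y2"
  shows "2 * bcf_eval P (ibil S x1 y1 x2 y2) (ibil T x1 y1 x2 y2) =
    bcf_eval (dprime p1) x1 y1 * bcf_eval p2 x2 y2 +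
      bcf_eval p1 x1 y1 * bcf_eval (dprime p2) x2 y2"
proof -
  have "of_int (bcf_eval P (ibil S x1 y1 x2 y2) (ibil T x1 y1 x2 y2)) =
      (of_int (bcf_eval (dprime p1) x1 y1) / 2 * of_int (bcf_eval p2 x2 y2) +
       of_int (bcf_eval p1 x1 y1) * (of_int (bcf_eval (dprime p2) x2 y2) / 2) :: rat)"
    using assms unfolding bcf_prime_eq_dprime bcf_eval_of_int[symmetric]
      bil_eval_of_int[symmetric] by blast
  then have "(of_int (2 * bcf_eval P (ibil S x1 y1 x2 y2) (ibil T x1 y1 x2 y2)) :: rat) =
     of_int (bcf_eval (dprime p1) x1 y1 * bcf_eval p2 x2 y2 +
      bcf_eval p1 x1 y1 * bcf_eval (dprime p2) x2 y2)"
    by (simp add: field_simps)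
  then show ?thesis by (simp only: of_int_eq_iff)
qed

lemma composed_via_int:
  assumes "composed_via D p1 p2 P S T"
  shows "2 * bcf_eval P (ibil S x1 y1 x2 y2) (ibil T x1 y1 x2 y2) =
    bcf_eval (dprime p1) x1 y1 * bcf_eval p2 x2 y2 +
      bcf_eval p1 x1 y1 * bcf_eval (dprime p2) x2 y2"
  using assms unfolding composed_via_def by (blast intro: composition_identity_int)

lemma bil_pencil:
  assumes "\<And>x1 y1 x2 y2. 2 * bcf_eval P (ibil (s0, s1, s2, s3) x1 y1 x2 y2) (ibil (t0, t1, t2, t3) x1 y1 x2 y2) =
    bcf_eval (dprime p1) x1 y1 * bcf_eval p2 x2 y2 +
      bcf_eval p1 x1 y1 * bcf_eval (dprime p2) x2 y2"
  shows "bcf_comb 2 (bcf_subst P (s0 * x + s2 * y) (s1 * x + s3 * y) (t0 * x + t2 * y) (t1 * x + t3 * y)) 0 P =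
    bcf_comb (bcf_eval (dprime p1) x y) p2 (bcf_eval p1 x y) (dprime p2)"
  using assms by (intro bcf_eqI) (simp add: bcf_eval_comb bcf_eval_subst ibil_def)

lemma span_quad:
  "of_int n0 * a + of_int n1 * b + of_int n2 * c + of_int n3 * d \<in> zm.span {a, b, c, d}"
  unfolding int_scale_def[symmetric] by (intro zm.span_add zm.span_scale zm.span_base) auto

text \<open>The three weighted expressions are the coefficients of the determinant of
  \<open>(x2, y2)\<close> to \<open>(X, Y)\<close> as a quadratic form in \<open>(x1, y1)\<close>.
  When they generate the unit ideal, the columns of the matrix generate the whole lattice.\<close>

lemma span_bilinear_coeffs:
  fixes A B :: complex
  assumes "u * (s0 * t1 - s1 * t0) + v * (s0 * t3 - s3 * t0 + s2 * t1 - s1 * t2)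
      + r * (s2 * t3 - s3 * t2) = 1"
    and e: "e0 = of_int s0 * A + of_int t0 * B" "e1 = of_int s1 * A + of_int t1 * B"
      "e2 = of_int s2 * A + of_int t2 * B" "e3 = of_int s3 * A + of_int t3 * B"
  shows "zm.span {A, B} = zm.span {e0, e1, e2, e3}"
proof (rule zspan_eqI)
  have 1: "of_int u * (of_int s0 * of_int t1 - of_int s1 * of_int t0)
      + of_int v * (of_int s0 * of_int t3 - of_int s3 * of_int t0 + of_int s2 * of_int t1 - of_int s1 * of_int t2)
      + of_int r * (of_int s2 * of_int t3 - of_int s3 * of_int t2) = (1 :: complex)"
    using arg_cong[OF assms(1), of complex_of_int] by simp
  \<comment> \<open>Cramer's rule for the column pairs 01, 03, 21 and 23, weighted by
    \<open>u\<close>, \<open>v\<close>, \<open>v\<close> and \<open>r\<close>.\<close>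
  have "A = of_int (u * t1 + v * t3) * e0 + of_int (- u * t0 - v * t2) * e1
      + of_int (v * t1 + r * t3) * e2 + of_int (- v * t0 - r * t2) * e3"
    "B = of_int (- u * s1 - v * s3) * e0 + of_int (u * s0 + v * s2) * e1
      + of_int (- v * s1 - r * s3) * e2 + of_int (v * s0 + r * s2) * e3"
    unfolding e of_int_add of_int_diff of_int_mult of_int_minus using 1 by Groebner_Basis.algebra+
  then show "{A, B} \<subseteq> zm.span {e0, e1, e2, e3}"
    by (metis span_quad insert_subset empty_subsetI)
  show "{e0, e1, e2, e3} \<subseteq> zm.span {A, B}" unfolding e by (auto simp: in_span_pair)
qed

context nonsquare_disc
begin

lemma span_lat_times_lat: "zm.span (A * (lat p * lat q)) = zm.span (A * {1, rt q, rt p, rt p * rt q})"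
proof -
  have "zm.span (A * (lat p * lat q)) = zm.span ((A * lat p) * {1, rt q})"
    unfolding lat_def mult.assoc[symmetric] times_span ..
  also have "\<dots> = zm.span ((A * {1, rt q}) * {1, rt p})"
    unfolding lat_def mult.assoc mult.commute[of "zm.span {1, rt p}"] unfolding mult.assoc[symmetric] times_span ..
  also have "A * {1, rt q} * {1, rt p} = A * {1, rt q, rt p, rt p * rt q}"
    unfolding mult.assoc by (rule arg_cong[of _ _ "(*) A"]) (auto simp: set_times_def mult.commute)
  finally show ?thesis .
qed

lemma cval_mult:
  assumes "2 * bcf_eval P x y = bcf_eval (dprime p1) x1 y1 * bcf_eval p2 x2 y2 +
      bcf_eval p1 x1 y1 * bcf_eval (dprime p2) x2 y2"
    and "2 * bcf_eval (dprime P) x y = 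
      D * bcf_eval p1 x1 y1 * bcf_eval p2 x2 y2 + bcf_eval (dprime p1) x1 y1 * bcf_eval (dprime p2) x2 y2"
  shows "cval P (of_int x) (of_int y) = cval p1 (of_int x1) (of_int y1) * cval p2 (of_int x2) (of_int y2)"
proof -
  have "4 * cval P (of_int x) (of_int y) = of_int (2 * bcf_eval (dprime P) x y) + 2 * of_int (2 * bcf_eval P x y) * omega"
    unfolding cval_of_int by (simp add: field_simps)
  also have "\<dots> = (of_int (bcf_eval (dprime p1) x1 y1) + 2 * of_int (bcf_eval p1 x1 y1) * omega) *
      (of_int (bcf_eval (dprime p2) x2 y2) + 2 * of_int (bcf_eval p2 x2 y2) * omega)"
    unfolding assms of_int_add of_int_mult omega_square[symmetric] by Groebner_Basis.algebra
  also have "\<dots> = (2 * cval p1 (of_int x1) (of_int y1)) * (2 * cval p2 (of_int x2) (of_int y2))"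
    unfolding cval_of_int by (simp add: field_simps)
  finally show ?thesis by simp
qed

text \<open>Comparing coefficients of the cubes, first in \<open>z\<close> and then in
  \<open>y\<close>, shows that \<open>X + rt P Y\<close> is \<open>c\<close> times the product of
  the two linear factors. The primitive minors then make the four products generate
  \<open>lat P\<close>.\<close>

lemma lat_comp_if_cval_mult:
  assumes p1: "p1 \<in> proj_bcfs D" and p2: "p2 \<in> proj_bcfs D" and P: "P \<in> proj_bcfs D"
    and minors: "s0 * t1 - s1 * t0 = hess0 p1" "s0 * t3 - s3 * t0 + s2 * t1 - s1 * t2 = hess1 p1"
      "s2 * t3 - s3 * t2 = hess2 p1"
    and cv: "\<And>y z. cval P (of_int (s0 + s1 * z + s2 * y + s3 * y * z)) (of_int (t0 + t1 * z + t2 * y + t3 * y * z))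
      = cval p1 1 (of_int y) * cval p2 1 (of_int z)"
  shows "lat_comp p1 p2 P"
proof -
  have d: "bcf_disc p1 = D" "bcf_disc p2 = D" "bcf_disc P = D"
    using p1 p2 P by (simp_all add: proj_bcfs_iff)
  define c e1 e2 e3 where e: "c = of_int s0 + of_int t0 * rt P" "e1 = of_int s1 + of_int t1 * rt P"
    "e2 = of_int s2 + of_int t2 * rt P" "e3 = of_int s3 + of_int t3 * rt P"
  define A L where "A = lead P" and "L = lead p1 * lead p2"
  have L0: "L \<noteq> 0" using lead_nonzero d by (simp add: L_def)
  have cube: "A * ((c + e2 * of_int y) + (e1 + e3 * of_int y) * of_int z)^3 =
      L * (1 + rt p1 * of_int y)^3 * (1 + rt p2 * of_int z)^3" for y z
    using cv[of z y] unfolding cval_cube[OF d(1)] cval_cube[OF d(2)] cval_cube[OF d(3)] e A_def L_def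
    by (simp add: algebra_simps)
  have y: "A * (c + e2 * of_int y)^3 = L * (1 + rt p1 * of_int y)^3"
    "A * (c + e2 * of_int y)^2 * (e1 + e3 * of_int y) = L * (1 + rt p1 * of_int y)^3 * rt p2" for y
  proof -
    define a b R where "a = c + e2 * of_int y" "b = e1 + e3 * of_int y" "R = L * (1 + rt p1 * of_int y)^3"
    have "A * a^3 + (3 * A * a^2 * b) * of_int z + (3 * A * a * b^2) * of_int z^2 + (A * b^3) * of_int z^3 =
        R + (3 * R * rt p2) * of_int z + (3 * R * rt p2^2) * of_int z^2 + (R * rt p2^3) * of_int z^3" for z
      using cube[of y z] unfolding a_b_R_def[symmetric] by Groebner_Basis.algebra
    from cubic_coeffs_eq(1,2)[OF this]
    show "A * (c + e2 * of_int y)^3 = L * (1 + rt p1 * of_int y)^3"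
      "A * (c + e2 * of_int y)^2 * (e1 + e3 * of_int y) = L * (1 + rt p1 * of_int y)^3 * rt p2"
      unfolding a_b_R_def by (simp_all add: mult.assoc)
  qed
  have "A * c^3 + (3 * A * c^2 * e2) * of_int y + (3 * A * c * e2^2) * of_int y^2 + (A * e2^3) * of_int y^3 =
        L + (3 * L * rt p1) * of_int y + (3 * L * rt p1^2) * of_int y^2 + (L * rt p1^3) * of_int y^3" for y
    using y(1)[of y] by Groebner_Basis.algebra
  from cubic_coeffs_eq(1,2)[OF this] have c: "A * c^3 = L" and 2: "A * c^2 * e2 = L * rt p1"
    by (simp_all add: mult.assoc)
  have "A * c^2 * e1 + (A * (2 * c * e2 * e1 + c^2 * e3)) * of_int y
      + (A * (e2^2 * e1 + 2 * c * e2 * e3)) * of_int y^2 + (A * e2^2 * e3) * of_int y^3 =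
        L * rt p2 + (3 * L * rt p1 * rt p2) * of_int y + (3 * L * rt p1^2 * rt p2) * of_int y^2
      + (L * rt p1^3 * rt p2) * of_int y^3" for y
    using y(2)[of y] by Groebner_Basis.algebra
  from cubic_coeffs_eq(1,2)[OF this]
  have 1: "A * c^2 * e1 = L * rt p2" and 3: "A * (2 * c * e2 * e1 + c^2 * e3) = 3 * L * rt p1 * rt p2"
    by (simp_all add: mult.assoc)
  have nz: "A * c^2 \<noteq> 0" using c L0 by auto
  have "A * c^2 * e1 = A * c^2 * (c * rt p2)" "A * c^2 * e2 = A * c^2 * (c * rt p1)"
    using 1 2 c by Groebner_Basis.algebra+
  then have e12: "e1 = c * rt p2" "e2 = c * rt p1" using nz by simp_all
  have "A * c^2 * e3 = A * c^2 * (c * (rt p1 * rt p2))"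
    using 3 c unfolding e12 by Groebner_Basis.algebra
  then have e3: "e3 = c * (rt p1 * rt p2)" using nz by simp
  obtain u v r where "u * hess0 p1 + v * hess1 p1 + r * hess2 p1 = 1" using p1 by (auto simp: proj_bcfs_iff)
  then have "zm.span {1, rt P} = zm.span {c, e1, e2, e3}"
    unfolding minors[symmetric] by (rule span_bilinear_coeffs) (simp_all add: e)
  also have "{c, e1, e2, e3} = {c} * {1, rt p2, rt p1, rt p1 * rt p2}"
    unfolding e12 e3 by (auto simp: set_times_def)
  also have "zm.span \<dots> = zm.span ({c} * (lat p1 * lat p2))" unfolding span_lat_times_lat ..
  finally show ?thesis unfolding lat_comp_def lat_def[of P] using c unfolding A_def L_def by blast
qed

text \<open>Once the determinant is known with its sign, covariance of \<open>dprime\<close>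
  supplies the rational component of the identity, and \<open>cval\<close> is
  multiplicative.\<close>

lemma is_composition_imp_lat_comp:
  assumes p1: "p1 \<in> proj_bcfs D" and p2: "p2 \<in> proj_bcfs D" and comp: "is_composition D p1 p2 P"
  shows "lat_comp p1 p2 P"
proof -
  obtain s0 s1 s2 s3 t0 t1 t2 t3 where via: "composed_via D p1 p2 P (s0, s1, s2, s3) (t0, t1, t2, t3)"
    and orient: "oriented p1 (s0, s1, s2, s3) (t0, t1, t2, t3)"
    using comp unfolding is_composition_def by (metis prod_cases4)
  have P: "P \<in> proj_bcfs D" using via unfolding composed_via_def by blast
  have d: "bcf_disc p1 = D" "bcf_disc p2 = D" "bcf_disc P = D"
    using p1 p2 P by (simp_all add: proj_bcfs_iff)
  have D0: "D \<noteq> 0" using nonsquare by auto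
  define d0 d1 d2 where dd: "d0 = s0 * t1 - s1 * t0" "d1 = s0 * t3 - s3 * t0 + s2 * t1 - s1 * t2" "d2 = s2 * t3 - s3 * t2"
  note pencil = bil_pencil[OF composed_via_int[OF via]]
  have syz: "bcf_eval (dprime p1) x y ^ 2 - bcf_disc p2 * bcf_eval p1 x y ^ 2 = 4 * hess p1 x y ^ 3" for x y
    using bcf_syzygy[of p1 x y] d by simp
  have det: "(s0 * 1 + s2 * y) * (t1 * 1 + t3 * y) - (s1 * 1 + s3 * y) * (t0 * 1 + t2 * y) = d0 + d1 * y + d2 * y^2" for y
    unfolding dd by Groebner_Basis.algebra
  have sq: "(d0 + d1 * y + d2 * y^2)^2 = hess p1 1 y ^ 2" for y
  proof -
    have "(d0 + d1 * y + d2 * y^2)^6 = hess p1 1 y ^ 6"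
      using pencil_covariants(4)[OF pencil[of 1 y] syz] D0 unfolding det d by simp
    \<comment> \<open>Sixth powers determine the determinant only up to sign at each
      \<open>y\<close>, so squares are kept; the signs are tied together below.\<close>
    then have "((d0 + d1 * y + d2 * y^2)^2)^3 = (hess p1 1 y ^ 2)^3"
      by (simp add: power_mult[symmetric])
    then show ?thesis by (rule power_eq_imp_eq_base) simp_all
  qed
  have "d0 * hess0 p1 \<ge> 0" using orient by (cases p1) (simp add: dd)
  moreover have "d0^2 = hess0 p1 ^ 2" using sq[of 0] by (simp add: hess_def)
  ultimately have d0: "d0 = hess0 p1"
    using hess0_nonzero[OF d(1)] by (auto simp: power2_eq_iff zero_le_mult_iff)
  have h0: "hess0 p1 \<noteq> 0" using hess0_nonzero d by simp
  \<comment> \<open>The difference of the two squared quadratics, sorted by powers of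
    \<open>y\<close>. The sign fixed at \<open>y = 0\<close> propagates: the linear coefficient
    forces \<open>d1\<close>, then the quadratic one forces \<open>d2\<close>.\<close>
  have "0 + (2 * hess0 p1 * (d1 - hess1 p1)) * of_int y
      + (2 * hess0 p1 * (d2 - hess2 p1) + (d1 - hess1 p1) * (d1 + hess1 p1)) * of_int y ^2
      + (2 * d1 * d2 - 2 * hess1 p1 * hess2 p1) * of_int y ^3 + (d2^2 - hess2 p1 ^ 2) * of_int y^4 = 0" for y
  proof -
    have "(hess0 p1 + d1 * y + d2 * y^2)^2 = (hess0 p1 + hess1 p1 * y + hess2 p1 * y^2)^2"
      using sq[of y] unfolding d0 by (simp add: hess_def)
    then show ?thesis unfolding of_int_eq_id id_apply by Groebner_Basis.algebra
  qed
  from quartic_coeffs_zero(2,3)[OF this] h0 have d12: "d1 = hess1 p1" "d2 = hess2 p1" by auto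
  have cv: "cval P (of_int (s0 + s1 * z + s2 * y + s3 * y * z)) (of_int (t0 + t1 * z + t2 * y + t3 * y * z))
      = cval p1 1 (of_int y) * cval p2 1 (of_int z)" for y z
  proof -
    let ?X = "s0 + s1 * z + s2 * y + s3 * y * z" and ?Y = "t0 + t1 * z + t2 * y + t3 * y * z"
    have XY: "(s0 * 1 + s2 * y) * 1 + (s1 * 1 + s3 * y) * z = ?X" "(t0 * 1 + t2 * y) * 1 + (t1 * 1 + t3 * y) * z = ?Y"
      by (simp_all add: algebra_simps)
    have h: "hess p1 1 y \<noteq> 0" using hess_anisotropic[OF d(1), of 1 y] by auto
    have det': "d0 + d1 * y + d2 * y^2 = hess p1 1 y" unfolding d0 d12 hess_def by simp
    have "hess p1 1 y ^ 3 * (2 * bcf_eval (dprime P) ?X ?Y) = hess p1 1 y ^ 3 *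
       (D * bcf_eval p1 1 y * bcf_eval p2 1 z + bcf_eval (dprime p1) 1 y * bcf_eval (dprime p2) 1 z)"
      using pencil_covariants(5)[OF pencil[of 1 y] syz, of 1 z] unfolding det det' XY d
      by (simp only: ac_simps)
    then have "2 * bcf_eval (dprime P) ?X ?Y =
       D * bcf_eval p1 1 y * bcf_eval p2 1 z + bcf_eval (dprime p1) 1 y * bcf_eval (dprime p2) 1 z"
      using h by simp
    moreover have "2 * bcf_eval P ?X ?Y =
       bcf_eval (dprime p1) 1 y * bcf_eval p2 1 z + bcf_eval p1 1 y * bcf_eval (dprime p2) 1 z"
      using composed_via_int[OF via, of 1 y 1 z] unfolding ibil_def prod.case XY .
    ultimately show ?thesis using cval_mult[of P ?X ?Y p1 1 y p2 1 z] by simp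
  qed
  show ?thesis using lat_comp_if_cval_mult[OF p1 p2 P _ _ _ cv] d0 d12 unfolding dd by blast
qed

end

section \<open>The quadratic order and existence of compositions\<close>

text \<open>An integral bivector satisfying the Pluecker relation is decomposable over the integers.
  The matrix is normalised by \<open>t0 = 0\<close> and \<open>s0 = d\<close>, the gcd of the minors
  involving column 0.\<close>

lemma plucker_realization:
  fixes m01 m02 m03 m12 m13 m23 :: int
  assumes "m01 \<noteq> 0" and rel: "m01 * m23 - m02 * m13 + m03 * m12 = 0"
  obtains s0 s1 s2 s3 t0 t1 t2 t3 where
    "s0 * t1 - s1 * t0 = m01" "s0 * t2 - s2 * t0 = m02" "s0 * t3 - s3 * t0 = m03"
    "s1 * t2 - s2 * t1 = m12" "s1 * t3 - s3 * t1 = m13" "s2 * t3 - s3 * t2 = m23"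
proof -
  define d where "d = gcd m01 (gcd m02 m03)"
  have "d \<noteq> 0" using assms by (simp add: d_def)
  have "d dvd m01" "d dvd m02" "d dvd m03" unfolding d_def by (auto intro: dvd_trans[OF gcd_dvd2])
  then obtain t1 t2 t3 where t: "m01 = d * t1" "m02 = d * t2" "m03 = d * t3" by (auto elim!: dvdE)
  obtain k k' where k: "k * m02 + k' * m03 = gcd m02 m03" using bezout_int by blast
  obtain k1 k'' where "k1 * m01 + k'' * gcd m02 m03 = d" unfolding d_def using bezout_int by blast
  then have "k1 * m01 + k'' * (k * m02 + k' * m03) = d" unfolding k .
  then have "d * (k1 * t1 + k'' * k * t2 + k'' * k' * t3) = d * 1" unfolding t by (simp add: algebra_simps)
  then obtain k2 k3 where one: "k1 * t1 + k2 * t2 + k3 * t3 = 1" using \<open>d \<noteq> 0\<close> by (metis mult_cancel_left)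
  have "d * (t1 * m23 - t2 * m13 + t3 * m12) = 0" using rel unfolding t by (simp add: algebra_simps)
  then have orth: "t1 * m23 - t2 * m13 + t3 * m12 = 0" using \<open>d \<noteq> 0\<close> by simp
  \<comment> \<open>With \<open>n = (m23, - m13, m12)\<close>, which is orthogonal to \<open>t\<close>, the vector \<open>s = k \<times> n\<close> satisfies
    \<open>s \<times> t = (k \<cdot> t) n - (n \<cdot> t) k = n\<close>.\<close>
  define s1 s2 s3 where s: "s1 = k2 * m12 + k3 * m13" "s2 = k3 * m23 - k1 * m12" "s3 = - k1 * m13 - k2 * m23"
  have "s1 * t2 - s2 * t1 = m12" "s1 * t3 - s3 * t1 = m13" "s2 * t3 - s3 * t2 = m23"
    using one orth unfolding s by Groebner_Basis.algebra+
  with that[of d t1 s1 0 t2 s2 t3 s3] show ?thesis by (simp add: t)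
qed

locale quadratic_disc = nonsquare_disc +
  assumes mod4: "D mod 4 = 0 \<or> D mod 4 = 1"
begin

text \<open>The parity of \<open>D\<close>, chosen so that \<open>(par + sqrt D) / 2\<close>
  generates the order of discriminant \<open>D\<close>.\<close>

definition par :: int where "par = D mod 2"

definition ord_gen :: complex where "ord_gen = of_int par / 2 + omega"

definition quad_ord :: "complex set" where "quad_ord = zm.span {1, ord_gen}"

text \<open>The form of the pair (\<open>quad_ord\<close>, 1): the \<open>omega\<close>-component of
  \<open>(x + ord_gen y)^3\<close>.\<close>

definition id_form :: "int bcf" where "id_form = BCF 0 1 par ((D - par) div 4 + par)"

lemma par_cases: "par = 0 \<or> par = 1" unfolding par_def by presburger

lemma par_square: "par^2 = par" using par_cases by auto

lemma par_disc: "4 * ((D - par) div 4) = D - par" unfolding par_def using mod4 by presburger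

lemma id_form_hess: "hess0 id_form = 1" "hess1 id_form = par" "hess2 id_form = - ((D - par) div 4)"
  using par_square by (simp_all add: id_form_def)

lemma id_form_proj: "id_form \<in> proj_bcfs D"
proof -
  have "1 * hess0 id_form + 0 * hess1 id_form + 0 * hess2 id_form = 1" by (simp add: id_form_hess)
  moreover have "bcf_disc id_form = D" using par_disc by (simp add: bcf_disc_hess id_form_hess par_square)
  ultimately show ?thesis unfolding proj_bcfs_iff by blast
qed

lemma lat_id_form: "lat id_form = quad_ord"
  unfolding lat_def quad_ord_def rt_def id_form_hess ord_gen_def by simp

lemma lead_id_form: "lead id_form = 1"
  by (simp add: lead_def cval_def id_form_def)

lemma hess1_par:
  assumes "bcf_disc p = D"
  obtains j where "hess1 p = par + 2 * j"
proof -
  have "even (hess1 p - par)"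
  proof -
    have "hess1 p ^ 2 = D + 2 * (2 * hess0 p * hess2 p)" using assms unfolding bcf_disc_hess by simp
    then have "even (hess1 p ^ 2) \<longleftrightarrow> even D" by simp
    then show ?thesis unfolding par_def by simp
  qed
  then show ?thesis using that by (metis add.commute diff_add_cancel evenE)
qed

lemma ord_gen_rt:
  assumes "bcf_disc p = D" "hess1 p = par + 2 * j"
  shows "ord_gen = of_int (hess0 p) * rt p - of_int j"
    and "ord_gen * rt p = of_int (par + j) * rt p - of_int (hess2 p)"
proof -
  have o: "2 * ord_gen = of_int par + 2 * omega" by (simp add: ord_gen_def)
  have r: "2 * of_int (hess0 p) * rt p = of_int par + 2 * of_int j + 2 * omega"
    using hess0_rt[OF assms(1)] unfolding assms(2) by simp
  have "2 * ord_gen = 2 * (of_int (hess0 p) * rt p - of_int j)" using o r by Groebner_Basis.algebra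
  then show g: "ord_gen = of_int (hess0 p) * rt p - of_int j" by (simp only: mult_cancel_left) simp
  show "ord_gen * rt p = of_int (par + j) * rt p - of_int (hess2 p)"
    unfolding g using rt_root[OF assms(1)] unfolding assms(2)
    by (simp add: power2_eq_square algebra_simps)
qed

text \<open>Multiplication by \<open>ord_gen\<close> maps the basis \<open>1\<close>,
  \<open>rt p\<close> into \<open>lat p\<close>, so the order acts on the lattice and is neutral for
  products.\<close>

lemma span_quad_ord_times_lat: "zm.span (quad_ord * lat p) = lat p" if p: "bcf_disc p = D"
proof -
  obtain j where j: "hess1 p = par + 2 * j" using hess1_par[OF p] .
  have "zm.span (quad_ord * lat p) = zm.span ({1, ord_gen} * {1, rt p})"
    unfolding quad_ord_def lat_def times_span span_times_span ..
  also have "{1, ord_gen} * {1, rt p} = {1, rt p, ord_gen, ord_gen * rt p}"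
    by (auto simp: set_times_def)
  also have "zm.span \<dots> = zm.span {1, rt p}"
  proof (rule zspan_eqI)
    have "1 = of_int 1 * 1 + of_int 0 * rt p" "rt p = of_int 0 * 1 + of_int 1 * rt p"
      "ord_gen = of_int (- j) * 1 + of_int (hess0 p) * rt p"
      "ord_gen * rt p = of_int (- hess2 p) * 1 + of_int (par + j) * rt p"
      using ord_gen_rt[OF p j] by simp_all
    then show "{1, rt p, ord_gen, ord_gen * rt p} \<subseteq> zm.span {1, rt p}"
      by (metis in_span_pair insert_subset empty_subsetI)
    show "{1, rt p} \<subseteq> zm.span {1, rt p, ord_gen, ord_gen * rt p}" by (auto intro: zm.span_base)
  qed
  finally show ?thesis unfolding lat_def .
qed

text \<open>These are the coefficients of the cube in the basis \<open>1\<close>,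
  \<open>ord_gen\<close>. They are integral because each coefficient of \<open>dprime p\<close> is
  congruent to \<open>par\<close> times that of \<open>p\<close> modulo 2.\<close>

lemma lead_rt_powers:
  assumes p: "bcf_disc p = D" and j: "hess1 p = par + 2 * j" and "p = BCF a0 a1 a2 a3"
  shows "lead p = of_int (a1 * hess0 p - a0 * (j + par)) + of_int a0 * ord_gen"
    and "lead p * rt p = of_int (a2 * hess0 p - a1 * (j + par)) + of_int a1 * ord_gen"
    and "lead p * rt p ^ 2 = of_int (a3 * hess0 p - a2 * (j + par)) + of_int a2 * ord_gen"
    and "lead p * rt p ^ 3 = of_int (a3 * j - a2 * hess2 p) + of_int a3 * ord_gen"
proof -
  have BCF: "dprime p = BCF (2 * (a1 * hess0 p - a0 * (j + par)) + a0 * par) (2 * (a2 * hess0 p - a1 * (j + par)) + a1 * par)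
      (2 * (a3 * hess0 p - a2 * (j + par)) + a2 * par) (2 * (a3 * j - a2 * hess2 p) + a3 * par)"
  proof -
    have "a1 * a2 - a0 * a3 = par + 2 * j" using j assms(3) by simp
    then have "2 * j = a1 * a2 - a0 * a3 - par" by simp
    then show ?thesis unfolding assms(3) bcf_defs by (intro conjI; Groebner_Basis.algebra)
  qed
  have "lead p + (3 * (lead p * rt p)) * of_int y + (3 * (lead p * rt p^2)) * of_int y^2 + (lead p * rt p^3) * of_int y^3 =
     (of_int (a1 * hess0 p - a0 * (j + par)) + of_int a0 * ord_gen)
     + (3 * (of_int (a2 * hess0 p - a1 * (j + par)) + of_int a1 * ord_gen)) * of_int y
     + (3 * (of_int (a3 * hess0 p - a2 * (j + par)) + of_int a2 * ord_gen)) * of_int y^2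
     + (of_int (a3 * j - a2 * hess2 p) + of_int a3 * ord_gen) * of_int y^3" for y
  proof -
    have "lead p * (1 + rt p * of_int y)^3 = cval p 1 (of_int y)" by (simp add: cval_cube[OF p])
    also have "\<dots> = (of_int (a1 * hess0 p - a0 * (j + par)) + of_int a0 * ord_gen)
     + (3 * (of_int (a2 * hess0 p - a1 * (j + par)) + of_int a1 * ord_gen)) * of_int y
     + (3 * (of_int (a3 * hess0 p - a2 * (j + par)) + of_int a2 * ord_gen)) * of_int y^2
     + (of_int (a3 * j - a2 * hess2 p) + of_int a3 * ord_gen) * of_int y^3"
      unfolding cval_def BCF unfolding assms(3) ord_gen_def by (simp add: field_simps)
    finally show ?thesis by Groebner_Basis.algebra
  qed
  from cubic_coeffs_eq[OF this] 
  show "lead p = of_int (a1 * hess0 p - a0 * (j + par)) + of_int a0 * ord_gen"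
    "lead p * rt p = of_int (a2 * hess0 p - a1 * (j + par)) + of_int a1 * ord_gen"
    "lead p * rt p ^ 2 = of_int (a3 * hess0 p - a2 * (j + par)) + of_int a2 * ord_gen"
    "lead p * rt p ^ 3 = of_int (a3 * j - a2 * hess2 p) + of_int a3 * ord_gen"
    by (simp_all only: mult_cancel_left) simp_all
qed

text \<open>The cube lattice is generated by the coefficients of the cube, which lie in the order.
  It contains 1 by projectivity and is stable under the order, so it is the whole order.\<close>

lemma lat_cube:
  assumes "p \<in> proj_bcfs D"
  shows "zm.span ({lead p} * (lat p * lat p * lat p)) = quad_ord"
proof -
  have p: "bcf_disc p = D" using assms by (simp add: proj_bcfs_iff)
  obtain j where j: "hess1 p = par + 2 * j" using hess1_par[OF p] .
  obtain a0 a1 a2 a3 where a: "p = BCF a0 a1 a2 a3" by (cases p)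
  define f0 f1 f2 f3 where f: "f0 = lead p" "f1 = lead p * rt p" "f2 = lead p * rt p^2" "f3 = lead p * rt p^3"
  note f_ord = lead_rt_powers[OF p j a, folded f]
  define F where "F = zm.span ({lead p} * (lat p * lat p * lat p))"
  have "F = zm.span (({lead p} * lat p) * (lat p * lat p))"
    unfolding F_def by (simp only: ac_simps)
  also have "\<dots> = zm.span (({lead p} * {1, rt p, rt p, rt p * rt p}) * lat p)"
    unfolding span_lat_times_lat by (simp only: ac_simps)
  also have "\<dots> = zm.span (({lead p} * {1, rt p, rt p, rt p * rt p}) * {1, rt p})"
    unfolding lat_def times_span ..
  also have "({lead p} * {1, rt p, rt p, rt p * rt p}) * {1, rt p} = {f0, f1, f2, f3}"
    unfolding f by (auto simp: set_times_def power2_eq_square power3_eq_cube mult.assoc)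
  finally have F: "F = zm.span {f0, f1, f2, f3}" .
  have "F \<subseteq> quad_ord"
    unfolding F quad_ord_def
  proof (intro zm.span_minimal zm.subspace_span)
    show "{f0, f1, f2, f3} \<subseteq> zm.span {1, ord_gen}"
      using in_span_pair[of _ 1 ord_gen] f_ord by (metis (no_types) mult.right_neutral insert_subset empty_subsetI)
  qed
  moreover have "1 \<in> F"
  proof -
    obtain u v r where uvr: "u * hess0 p + v * hess1 p + r * hess2 p = 1" using assms by (auto simp: proj_bcfs_iff)
    have J: "of_int par + 2 * of_int j = of_int a1 * of_int a2 - of_int a0 * (of_int a3 :: complex)"
      using arg_cong[OF j, of complex_of_int] unfolding a by simp
    \<comment> \<open>The integers \<open>a\<^sub>i f\<^sub>k - a\<^sub>k f\<^sub>i\<close> generate the square of the ideal of the Hessian coefficients,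
      which is the unit ideal by projectivity.\<close>
    have hh: "of_int a1 * f0 - of_int a0 * f1 = of_int (hess0 p ^ 2)"
      "of_int a2 * f1 - of_int a1 * f2 = of_int (hess0 p * hess2 p)"
      "of_int a3 * f2 - of_int a2 * f3 = of_int (hess2 p ^ 2)"
      "of_int a2 * f0 - of_int a0 * f2 = of_int (hess0 p * hess1 p)"
      "of_int a3 * f1 - of_int a1 * f3 = of_int (hess1 p * hess2 p)"
      "of_int a3 * f0 - of_int a0 * f3 = of_int (hess1 p ^ 2 - hess0 p * hess2 p)"
      unfolding f_ord a hess0.simps hess1.simps hess2.simps
        of_int_add of_int_mult of_int_diff of_int_power
      by (Groebner_Basis.algebra | use J in Groebner_Basis.algebra)+
    \<comment> \<open>The Bezout identity is squared because \<open>hh\<close> provides only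
      products of Hessian coefficients.\<close>
    have "of_int (u * hess0 p + v * hess1 p + r * hess2 p)^2 = (1 :: complex)" unfolding uvr by simp
    then have "of_int (u^2 * a1 + 2 * u * v * a2 + v^2 * a3) * f0
       + of_int (- (u^2) * a0 + (v^2 + 2 * u * r) * a2 + 2 * v * r * a3) * f1
       + of_int (- (v^2 + 2 * u * r) * a1 + r^2 * a3 - 2 * u * v * a0) * f2
       + of_int (- (r^2) * a2 - 2 * v * r * a1 - v^2 * a0) * f3 = 1"
      using hh unfolding of_int_add of_int_mult of_int_diff of_int_power of_int_minus of_int_numeral
      by Groebner_Basis.algebra
    then show ?thesis unfolding F by (metis span_quad)
  qed
  moreover have "quad_ord \<subseteq> zm.span (quad_ord * F)"
  proof
    fix z assume "z \<in> quad_ord"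
    then have "z * 1 \<in> quad_ord * F" using \<open>1 \<in> F\<close> by (rule set_times_intro)
    then show "z \<in> zm.span (quad_ord * F)" by (simp add: zm.span_base)
  qed
  moreover have "zm.span (quad_ord * F) = F"
  proof -
    have "zm.span (quad_ord * F) = zm.span (({lead p} * lat p * lat p) * zm.span (quad_ord * lat p))"
      unfolding F_def times_span by (simp only: ac_simps)
    also have "\<dots> = F" unfolding span_quad_ord_times_lat[OF p] F_def by (simp only: ac_simps)
    finally show ?thesis .
  qed
  ultimately show ?thesis unfolding F_def[symmetric] by blast
qed

lemma span_quad_ord_ord: "zm.span (quad_ord * quad_ord) = quad_ord"
  using span_quad_ord_times_lat[of id_form] id_form_proj by (simp add: lat_id_form proj_bcfs_iff)

text \<open>The cubes of the two lattices, scaled by their leading constants, are each the order,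
  and so is their product. This makes the coefficients of the composed form integral.\<close>

lemma lat_product_cube:
  assumes "p1 \<in> proj_bcfs D" "p2 \<in> proj_bcfs D"
    and "x \<in> zm.span (lat p1 * lat p2)" "y \<in> zm.span (lat p1 * lat p2)" "z \<in> zm.span (lat p1 * lat p2)"
  shows "lead p1 * lead p2 * (x * y * z) \<in> quad_ord"
proof -
  define L where "L = lat p1 * lat p2"
  have "lead p1 * lead p2 * (x * y * z) \<in> {lead p1} * {lead p2} * (zm.span L * zm.span L * zm.span L)"
    using assms(3-5) unfolding L_def by (intro set_times_intro) auto
  then have "lead p1 * lead p2 * (x * y * z) \<in> zm.span ({lead p1} * {lead p2} * (zm.span L * zm.span L * zm.span L))"
    by (rule zm.span_base)
  also have "\<dots> = zm.span (({lead p1} * {lead p2} * zm.span L * zm.span L) * L)"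
    unfolding mult.assoc[symmetric] times_span ..
  also have "\<dots> = zm.span (({lead p1} * {lead p2} * zm.span L * L) * L)"
    using times_span[of "{lead p1} * {lead p2} * zm.span L * L" L] by (simp only: ac_simps)
  also have "\<dots> = zm.span (({lead p1} * {lead p2} * L * L) * L)"
    using times_span[of "{lead p1} * {lead p2} * L * L" L] by (simp only: ac_simps)
  also have "\<dots> = zm.span (zm.span ({lead p1} * (lat p1 * lat p1 * lat p1)) * zm.span ({lead p2} * (lat p2 * lat p2 * lat p2)))"
    unfolding times_span span_times_span L_def by (simp only: ac_simps)
  also have "\<dots> = quad_ord" unfolding lat_cube[OF assms(1)] lat_cube[OF assms(2)] span_quad_ord_ord ..
  finally show ?thesis .
qed

section \<open>Construction of a composition\<close>

lemma cval_of_rat: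
  "cval p (of_rat x) (of_rat y) =
     of_rat (bcf_eval (bcf_prime (rat_bcf p)) x y) + of_rat (bcf_eval (rat_bcf p) x y) * omega"
  unfolding bcf_prime_eq_dprime cval_def
  by (cases p) (simp add: of_rat_add of_rat_mult of_rat_power of_rat_divide of_rat_minus of_rat_diff)

lemma bil_eval_of_rat:
  "of_rat (bil_eval (s0, s1, s2, s3) x1 y1 x2 y2) =
     (of_int s0 * (of_rat x1 * of_rat x2) + of_int s1 * (of_rat x1 * of_rat y2) +
      of_int s2 * (of_rat y1 * of_rat x2) + of_int s3 * (of_rat y1 * of_rat y2) :: complex)"
  by (simp add: of_rat_add of_rat_mult)

lemma in_ord:
  assumes "z \<in> quad_ord"
  obtains u v :: int where "z = of_rat (of_int u / 2) + of_int v * omega"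
proof -
  obtain m n where "z = of_int m * 1 + of_int n * ord_gen" using assms unfolding quad_ord_def in_span_pair by blast
  then have "z = of_rat (of_int (2 * m + n * par) / 2) + of_int n * omega"
    by (simp add: ord_gen_def of_rat_divide of_rat_add of_rat_mult field_simps)
  then show ?thesis by (rule that)
qed

text \<open>The discriminant follows from one nonzero value \<open>h\<close> of the Hessian of
  \<open>p1\<close>. A common divisor of the Hessian of \<open>P\<close> divides \<open>h\<close>
  times that of \<open>p2\<close>, hence every such \<open>h\<close> as \<open>p2\<close> is
  primitive, hence 1 as \<open>p1\<close> is.\<close>

lemma proj_bcfs_if_pencil:
  assumes p1: "p1 \<in> proj_bcfs D" and p2: "p2 \<in> proj_bcfs D"
    and minors: "s0 * t1 - s1 * t0 = hess0 p1" "s0 * t3 - s3 * t0 + s2 * t1 - s1 * t2 = hess1 p1"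
      "s2 * t3 - s3 * t2 = hess2 p1"
    and id: "\<And>x1 y1 x2 y2. 2 * bcf_eval P (ibil (s0, s1, s2, s3) x1 y1 x2 y2) (ibil (t0, t1, t2, t3) x1 y1 x2 y2) =
      bcf_eval (dprime p1) x1 y1 * bcf_eval p2 x2 y2 +
      bcf_eval p1 x1 y1 * bcf_eval (dprime p2) x2 y2"
  shows "P \<in> proj_bcfs D"
proof -
  have d: "bcf_disc p1 = D" "bcf_disc p2 = D" using p1 p2 by (simp_all add: proj_bcfs_iff)
  have syz: "bcf_eval (dprime p1) x y ^ 2 - bcf_disc p2 * bcf_eval p1 x y ^ 2 = 4 * hess p1 x y ^ 3" for x y
    using bcf_syzygy[of p1 x y] d by simp
  have det: "(s0 * x + s2 * y) * (t1 * x + t3 * y) - (s1 * x + s3 * y) * (t0 * x + t2 * y) = hess p1 x y" for x y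
    unfolding hess_def minors[symmetric] by Groebner_Basis.algebra
  have "hess p1 1 0 \<noteq> 0" using hess_anisotropic[OF d(1), of 1 0] by auto
  then have "bcf_disc P = D" using pencil_covariants(4)[OF bil_pencil[OF id, of 1 0] syz, unfolded det] d by simp
  moreover have "\<exists>u v r. u * hess0 P + v * hess1 P + r * hess2 P = 1"
  proof -
    define g where "g = gcd (hess0 P) (gcd (hess1 P) (hess2 P))"
    have g: "g dvd hess0 P" "g dvd hess1 P" "g dvd hess2 P"
      unfolding g_def by (auto intro: dvd_trans[OF gcd_dvd2])
    obtain u v r where one: "u * hess0 p2 + v * hess1 p2 + r * hess2 p2 = 1" using p2 by (auto simp: proj_bcfs_iff)
    have gh: "g dvd hess p1 x y" if "(x, y) \<noteq> (0, 0)" for x y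
    proof -
      define h where "h = hess p1 x y"
      define k l m n where "k = s0 * x + s2 * y" "l = s1 * x + s3 * y" "m = t0 * x + t2 * y" "n = t1 * x + t3 * y"
      have h: "h \<noteq> 0" using hess_anisotropic[OF d(1), of x y] that unfolding h_def by auto
      have c: "h^2 * hess P k m = h^2 * (h * hess0 p2)"
        "h^2 * (2 * hess0 P * k * l + hess1 P * (k * n + l * m) + 2 * hess2 P * m * n) = h^2 * (h * hess1 p2)"
        "h^2 * hess P l n = h^2 * (h * hess2 p2)"
        using pencil_covariants(1-3)[OF bil_pencil[OF id, of x y] syz, unfolded det] unfolding k_l_m_n_def h_def
        by (simp_all add: power2_eq_square power3_eq_cube mult.assoc)
      then have c': "h * hess0 p2 = hess P k m"
        "h * hess1 p2 = 2 * hess0 P * k * l + hess1 P * (k * n + l * m) + 2 * hess2 P * m * n"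
        "h * hess2 p2 = hess P l n"
        using h by auto
      have "g dvd h * hess0 p2" "g dvd h * hess1 p2" "g dvd h * hess2 p2"
        unfolding c' hess_def using g by (auto intro!: dvd_add)
      then have "g dvd u * (h * hess0 p2) + v * (h * hess1 p2) + r * (h * hess2 p2)"
        by (intro dvd_add dvd_mult[of _ "h * _"])
      also have "\<dots> = h * (u * hess0 p2 + v * hess1 p2 + r * hess2 p2)" by (simp add: algebra_simps)
      finally show ?thesis unfolding one h_def by simp
    qed
    \<comment> \<open>Three values of a binary quadratic form recover its three
      coefficients.\<close>
    have 0: "g dvd hess0 p1" "g dvd hess2 p1" "g dvd hess0 p1 + hess1 p1 + hess2 p1"
      using gh[of 1 0] gh[of 0 1] gh[of 1 1] by (simp_all add: hess_def)
    then have "g dvd hess1 p1" by (metis add_diff_cancel_left' add_diff_cancel_right' dvd_diff)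
    moreover obtain a b c where "a * hess0 p1 + b * hess1 p1 + c * hess2 p1 = 1" using p1 by (auto simp: proj_bcfs_iff)
    ultimately have "g dvd 1" using 0 by (metis dvd_add dvd_mult)
    then have "g = 1" unfolding g_def by simp
    then show ?thesis unfolding g_def gcd3_eq_1_iff .
  qed
  ultimately show ?thesis by (simp add: proj_bcfs_iff)
qed

lemma composition_exists:
  assumes p1: "p1 \<in> proj_bcfs D" and p2: "p2 \<in> proj_bcfs D"
  shows "\<exists>P. is_composition D p1 p2 P"
proof -
  have d: "bcf_disc p1 = D" "bcf_disc p2 = D" using p1 p2 by (simp_all add: proj_bcfs_iff)
  define h0 h1 h2 where h: "h0 = hess0 p1" "h1 = hess1 p1" "h2 = hess2 p1"
  define g0 g1 g2 where g: "g0 = hess0 p2" "g1 = hess1 p2" "g2 = hess2 p2"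
  obtain i where i: "h1 = par + 2 * i" using hess1_par[OF d(1)] unfolding h .
  obtain j where j: "g1 = par + 2 * j" using hess1_par[OF d(2)] unfolding g .
  \<comment> \<open>Equality of the two Hessian discriminants is exactly the Pluecker relation for
    the minors chosen below.\<close>
  have "h1^2 - 4 * h0 * h2 = g1^2 - 4 * g0 * g2" using d unfolding bcf_disc_hess h g by simp
  then have "4 * (h0 * h2 - g0 * g2 + (par + i + j) * (j - i)) = 0"
    unfolding i j by (simp add: power2_eq_square algebra_simps)
  then have rel: "h0 * h2 - g0 * g2 + (par + i + j) * (j - i) = 0" by simp
  have h0: "h0 \<noteq> 0" using hess0_nonzero[OF d(1)] by (simp add: h)
  \<comment> \<open>Gauss's system for the minors of the matrix of a direct composition of the two Hessians.\<close>
  obtain s0 s1 s2 s3 t0 t1 t2 t3 where m: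
    "s0 * t1 - s1 * t0 = h0" "s0 * t2 - s2 * t0 = g0" "s0 * t3 - s3 * t0 = par + i + j"
    "s1 * t2 - s2 * t1 = j - i" "s1 * t3 - s3 * t1 = g2" "s2 * t3 - s3 * t2 = h2"
    by (rule plucker_realization[OF h0 rel])
  have minors: "s0 * t1 - s1 * t0 = hess0 p1" "s0 * t3 - s3 * t0 + s2 * t1 - s1 * t2 = hess1 p1"
    "s2 * t3 - s3 * t2 = hess2 p1"
    using m i unfolding h by simp_all
  \<comment> \<open>Cramer's rule: \<open>A\<close>, \<open>B\<close> are solved from the first two
    columns, which are to represent \<open>1\<close> and \<open>rt p2\<close>.\<close>
  define A B where AB: "A = (of_int t1 - of_int t0 * rt p2) / of_int h0" "B = (of_int s0 * rt p2 - of_int s1) / of_int h0"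
  have h0A: "of_int h0 * A = of_int t1 - of_int t0 * rt p2" and h0B: "of_int h0 * B = of_int s0 * rt p2 - of_int s1"
    using h0 by (simp_all add: AB)
  have mc: "of_int s0 * of_int t1 - of_int s1 * of_int t0 = (of_int h0 :: complex)"
    "of_int s0 * of_int t2 - of_int s2 * of_int t0 = (of_int g0 :: complex)"
    "of_int s0 * of_int t3 - of_int s3 * of_int t0 = (of_int par + of_int i + of_int j :: complex)"
    "of_int s1 * of_int t2 - of_int s2 * of_int t1 = (of_int j - of_int i :: complex)"
    "of_int s1 * of_int t3 - of_int s3 * of_int t1 = (of_int g2 :: complex)"
    using m[THEN arg_cong[of _ _ complex_of_int]] by simp_all
  note r1 = ord_gen_rt[OF d(1) i[unfolded h], folded h] and r2 = ord_gen_rt[OF d(2) j[unfolded g], folded g]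
  have "of_int h0 * (of_int s0 * A + of_int t0 * B) = of_int h0 * 1"
    "of_int h0 * (of_int s1 * A + of_int t1 * B) = of_int h0 * rt p2"
    using h0A h0B mc(1) by Groebner_Basis.algebra+
  then have e01: "1 = of_int s0 * A + of_int t0 * B" "rt p2 = of_int s1 * A + of_int t1 * B"
    using h0 by simp_all
  \<comment> \<open>Expressing \<open>ord_gen\<close> through either form gives
    \<open>h0 rt p1 - i = g0 rt p2 - j\<close>, which explains the minors \<open>g0\<close> and
    \<open>j - i\<close>.\<close>
  have "of_int h0 * (of_int s2 * A + of_int t2 * B) = of_int h0 * rt p1"
    using h0A h0B mc(2,4) r1(1) r2(1) by Groebner_Basis.algebra
  then have e2: "rt p1 = of_int s2 * A + of_int t2 * B" using h0 by simp
  have "of_int h0 * (of_int s3 * A + of_int t3 * B) = of_int h0 * (rt p1 * rt p2)"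
    using h0A h0B mc(3,5) r1(1) r2(2) unfolding of_int_add by Groebner_Basis.algebra
  then have e3: "rt p1 * rt p2 = of_int s3 * A + of_int t3 * B" using h0 by simp
  obtain u v r where "u * hess0 p1 + v * hess1 p1 + r * hess2 p1 = 1" using p1 by (auto simp: proj_bcfs_iff)
  then have "zm.span {A, B} = zm.span {1, rt p2, rt p1, rt p1 * rt p2}"
    unfolding minors[symmetric] by (rule span_bilinear_coeffs[OF _ e01 e2 e3])
  also have "\<dots> = zm.span (lat p1 * lat p2)"
    using span_lat_times_lat[of "{1}" p1 p2] by (simp add: one_times_set)
  finally have "A \<in> zm.span (lat p1 * lat p2)" "B \<in> zm.span (lat p1 * lat p2)"
    by (auto intro: zm.span_base)
  note cube = lat_product_cube[OF p1 p2]
  define L where "L = lead p1 * lead p2"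
  \<comment> \<open>The coefficients of \<open>P\<close> are the \<open>omega\<close>-components of
    the coefficients of \<open>L (A X + B Y)^3\<close>.\<close>
  obtain u0 a0 where f0: "L * (A * A * A) = of_rat (of_int u0 / 2) + of_int a0 * omega"
    using in_ord[OF cube] \<open>A \<in> _\<close> \<open>B \<in> _\<close> unfolding L_def by metis
  obtain u1 a1 where f1: "L * (A * A * B) = of_rat (of_int u1 / 2) + of_int a1 * omega"
    using in_ord[OF cube] \<open>A \<in> _\<close> \<open>B \<in> _\<close> unfolding L_def by metis
  obtain u2 a2 where f2: "L * (A * B * B) = of_rat (of_int u2 / 2) + of_int a2 * omega"
    using in_ord[OF cube] \<open>A \<in> _\<close> \<open>B \<in> _\<close> unfolding L_def by metis
  obtain u3 a3 where f3: "L * (B * B * B) = of_rat (of_int u3 / 2) + of_int a3 * omega"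
    using in_ord[OF cube] \<open>A \<in> _\<close> \<open>B \<in> _\<close> unfolding L_def by metis
  define P where "P = BCF a0 a1 a2 a3"
  let ?S = "(s0, s1, s2, s3)" and ?T = "(t0, t1, t2, t3)"
  have id: "bcf_eval (rat_bcf P) (bil_eval ?S x1 y1 x2 y2) (bil_eval ?T x1 y1 x2 y2) =
      bcf_eval (bcf_prime (rat_bcf p1)) x1 y1 * bcf_eval (rat_bcf p2) x2 y2 +
      bcf_eval (rat_bcf p1) x1 y1 * bcf_eval (bcf_prime (rat_bcf p2)) x2 y2" for x1 y1 x2 y2
  proof -
    define X Y where "X = bil_eval ?S x1 y1 x2 y2" and "Y = bil_eval ?T x1 y1 x2 y2"
    define q1 q2 where "q1 = bcf_eval (bcf_prime (rat_bcf p1)) x1 y1" and "q2 = bcf_eval (bcf_prime (rat_bcf p2)) x2 y2"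
    define v1 v2 where "v1 = bcf_eval (rat_bcf p1) x1 y1" and "v2 = bcf_eval (rat_bcf p2) x2 y2"
    have prod: "(of_rat x1 + rt p1 * of_rat y1) * (of_rat x2 + rt p2 * of_rat y2) = A * of_rat X + B * of_rat Y"
      unfolding X_def Y_def bil_eval_of_rat using e01 e2 e3 by Groebner_Basis.algebra
    have "of_rat (q1 * q2 + of_int D / 4 * v1 * v2) + of_rat (q1 * v2 + v1 * q2) * omega =
        (of_rat q1 + of_rat v1 * omega) * (of_rat q2 + of_rat v2 * omega)"
    proof -
      have "of_rat (of_int D / 4) = omega^2" using omega_square[symmetric] by (simp add: of_rat_divide)
      then show ?thesis unfolding of_rat_add of_rat_mult by Groebner_Basis.algebra
    qed
    also have "\<dots> = cval p1 (of_rat x1) (of_rat y1) * cval p2 (of_rat x2) (of_rat y2)"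
      unfolding cval_of_rat q1_def q2_def v1_def v2_def ..
    also have "\<dots> = L * ((of_rat x1 + rt p1 * of_rat y1) * (of_rat x2 + rt p2 * of_rat y2))^3"
      unfolding cval_cube[OF d(1)] cval_cube[OF d(2)] L_def by (simp add: power_mult_distrib)
    also have "\<dots> = (L * (A * A * A)) * of_rat X ^ 3 + 3 * (L * (A * A * B)) * of_rat X ^ 2 * of_rat Y
        + 3 * (L * (A * B * B)) * of_rat X * of_rat Y ^ 2 + (L * (B * B * B)) * of_rat Y ^ 3"
      unfolding prod by Groebner_Basis.algebra
    also have "\<dots> = of_rat (of_int u0 / 2 * X^3 + 3 * (of_int u1 / 2) * X^2 * Y
          + 3 * (of_int u2 / 2) * X * Y^2 + of_int u3 / 2 * Y^3)
        + of_rat (bcf_eval (rat_bcf P) X Y) * omega"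
      by (simp only: f0 f1 f2 f3 P_def bcf.map bcf_eval.simps of_rat_add of_rat_mult of_rat_power
          of_rat_of_int_eq of_rat_numeral_eq) Groebner_Basis.algebra
    finally show ?thesis
      using omega_indep(2) unfolding q1_def q2_def v1_def v2_def X_def Y_def by metis
  qed
  have "2 * bcf_eval P (ibil ?S x1 y1 x2 y2) (ibil ?T x1 y1 x2 y2) =
      bcf_eval (dprime p1) x1 y1 * bcf_eval p2 x2 y2 +
      bcf_eval p1 x1 y1 * bcf_eval (dprime p2) x2 y2" for x1 y1 x2 y2
    using id by (rule composition_identity_int)
  then have "P \<in> proj_bcfs D" by (rule proj_bcfs_if_pencil[OF p1 p2 minors])
  then have "composed_via D p1 p2 P ?S ?T" unfolding composed_via_def using id by blast
  moreover have "oriented p1 ?S ?T" using minors(1) by (cases p1) simp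
  ultimately show ?thesis unfolding is_composition_def by blast
qed

section \<open>The group of classes\<close>

lemma lat_equiv_refl: "lat_equiv p p"
  unfolding lat_equiv_def by (intro exI[of _ 1]) (simp add: one_times_set lat_def zm.span_span)

lemma sl2_class_eq:
  assumes "p \<in> proj_bcfs D"
  shows "sl2_class D p = {q \<in> proj_bcfs D. lat_equiv p q}"
  using assms sl2_equiv_imp_lat_equiv lat_equiv_imp_sl2_equiv lat_equiv_sym
  unfolding sl2_class_def proj_bcfs_iff by blast

lemma lat_comp_exists:
  assumes "p1 \<in> proj_bcfs D" "p2 \<in> proj_bcfs D"
  obtains P where "P \<in> proj_bcfs D" "lat_comp p1 p2 P"
proof -
  obtain P where P: "is_composition D p1 p2 P" using composition_exists[OF assms] by blast
  then have "P \<in> proj_bcfs D" unfolding is_composition_def composed_via_def by blast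
  with P show ?thesis using is_composition_imp_lat_comp[OF assms] that by blast
qed

lemma lat_comp_id: "bcf_disc p = D \<Longrightarrow> lat_comp id_form p p"
  unfolding lat_comp_def lat_id_form lead_id_form
  by (intro exI[of _ 1]) (simp add: one_times_set span_quad_ord_times_lat)

text \<open>The scalar \<open>lead p / c\<close> turns the product into the scaled cube of
  \<open>lat p\<close>, which is the order. This provides inverses as well as exponent 3.\<close>

lemma lat_comp_cube:
  assumes p: "p \<in> proj_bcfs D" and "lat_comp p p q"
  shows "lat_comp q p id_form"
proof -
  have d: "bcf_disc p = D" using p by (simp add: proj_bcfs_iff)
  obtain c where c: "lat q = zm.span ({c} * (lat p * lat p))" "lead q * c^3 = lead p * lead p"
    using assms unfolding lat_comp_def by blast
  have "c \<noteq> 0" using c(2) lead_nonzero[OF d] by auto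
  have "zm.span ({lead p / c} * (lat q * lat p)) = zm.span (({lead p / c} * lat p) * zm.span ({c} * (lat p * lat p)))"
    unfolding c(1) by (simp only: ac_simps)
  also have "\<dots> = zm.span ({lead p / c} * {c} * (lat p * lat p * lat p))"
    unfolding times_span by (simp only: ac_simps)
  also have "\<dots> = quad_ord" using lat_cube[OF p] \<open>c \<noteq> 0\<close> by (simp add: singleton_times)
  finally have "quad_ord = zm.span ({lead p / c} * (lat q * lat p))" ..
  moreover have "(lead p / c)^3 = lead q * lead p"
    using c(2) \<open>c \<noteq> 0\<close> by (simp add: power_divide field_simps power3_eq_cube)
  ultimately show ?thesis unfolding lat_comp_def lat_id_form lead_id_form by auto
qed

section \<open>Multiplication of classes\<close>

text \<open>Collecting the products over all representatives avoids choosing any; that the result is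
  a single class is proved below.\<close>

definition comp_mult :: "int bcf set \<Rightarrow> int bcf set \<Rightarrow> int bcf set" where
  "comp_mult A B = {P \<in> proj_bcfs D. \<exists>p1 \<in> A. \<exists>p2 \<in> B. lat_comp p1 p2 P}"

definition comp_group :: "int bcf set monoid" where
  "comp_group = \<lparr>carrier = sl2_classes D, mult = comp_mult, one = sl2_class D id_form\<rparr>"

lemma comp_group_simps:
  "carrier comp_group = sl2_classes D" "mult comp_group = comp_mult" "one comp_group = sl2_class D id_form"
  by (simp_all add: comp_group_def)

lemma comp_mult_classes:
  assumes "p1 \<in> proj_bcfs D" "p2 \<in> proj_bcfs D" "P \<in> proj_bcfs D" "lat_comp p1 p2 P"
  shows "comp_mult (sl2_class D p1) (sl2_class D p2) = sl2_class D P"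
proof -
  have d: "bcf_disc q = D" if "q \<in> proj_bcfs D" for q using that by (simp add: proj_bcfs_iff)
  have "lat_equiv P R"
    if "R \<in> proj_bcfs D" "q1 \<in> proj_bcfs D" "q2 \<in> proj_bcfs D"
      "lat_equiv p1 q1" "lat_equiv p2 q2" "lat_comp q1 q2 R"
    for q1 q2 R
  proof -
    have "lat_comp p1 p2 R"
      using that assms lat_comp_cong[of q1 q2 p1 p2 R R] lat_equiv_sym lat_equiv_refl d by blast
    then show ?thesis using lat_comp_unique[of p1 p2 P R] that assms d by blast
  qed
  moreover have "lat_comp p1 p2 R" if "lat_equiv P R" for R
    using lat_comp_cong[of p1 p2 p1 p2 P R] that assms d lat_equiv_refl by blast
  ultimately show ?thesis
    unfolding comp_mult_def sl2_class_eq[OF assms(1)] sl2_class_eq[OF assms(2)] sl2_class_eq[OF assms(3)]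
    using assms lat_equiv_refl by blast
qed

lemma group_comp_group: "group comp_group"
proof (rule groupI, unfold comp_group_simps)
  fix A B assume "A \<in> sl2_classes D" "B \<in> sl2_classes D"
  then obtain a b where a: "a \<in> proj_bcfs D" "A = sl2_class D a" and b: "b \<in> proj_bcfs D" "B = sl2_class D b"
    unfolding sl2_classes_def by blast
  obtain P where "P \<in> proj_bcfs D" "lat_comp a b P" using lat_comp_exists[OF a(1) b(1)] .
  then show "comp_mult A B \<in> sl2_classes D"
    using comp_mult_classes a b unfolding sl2_classes_def by blast
next
  show "sl2_class D id_form \<in> sl2_classes D" using id_form_proj unfolding sl2_classes_def by blast
next
  fix A B C assume "A \<in> sl2_classes D" "B \<in> sl2_classes D" "C \<in> sl2_classes D"
  then obtain a b c where a: "a \<in> proj_bcfs D" "A = sl2_class D a" and b: "b \<in> proj_bcfs D" "B = sl2_class D b"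
    and c: "c \<in> proj_bcfs D" "C = sl2_class D c"
    unfolding sl2_classes_def by blast
  obtain u where u: "u \<in> proj_bcfs D" "lat_comp a b u" using lat_comp_exists[OF a(1) b(1)] .
  obtain v where v: "v \<in> proj_bcfs D" "lat_comp b c v" using lat_comp_exists[OF b(1) c(1)] .
  obtain x where x: "x \<in> proj_bcfs D" "lat_comp u c x" using lat_comp_exists[OF u(1) c(1)] .
  have "lat_comp a v x" using lat_comp_assoc[of b c a u x v] u v x b(1) c(1) by (simp add: proj_bcfs_iff)
  then show "comp_mult (comp_mult A B) C = comp_mult A (comp_mult B C)"
    using a b c u v x by (simp add: comp_mult_classes)
next
  fix A assume "A \<in> sl2_classes D"
  then obtain a where a: "a \<in> proj_bcfs D" "A = sl2_class D a" unfolding sl2_classes_def by blast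
  show "comp_mult (sl2_class D id_form) A = A"
    using a id_form_proj lat_comp_id[of a] by (simp add: comp_mult_classes proj_bcfs_iff[of a])
  obtain q where q: "q \<in> proj_bcfs D" "lat_comp a a q" using lat_comp_exists[OF a(1) a(1)] .
  then have "comp_mult (sl2_class D q) A = sl2_class D id_form"
    using a id_form_proj lat_comp_cube[of a q] by (simp add: comp_mult_classes)
  then show "\<exists>B \<in> sl2_classes D. comp_mult B A = sl2_class D id_form"
    using q unfolding sl2_classes_def by blast
qed

lemma comp_group_ord:
  assumes "A \<in> carrier comp_group" "A \<noteq> \<one>\<^bsub>comp_group\<^esub>"
  shows "group.ord comp_group A = 3"
proof -
  interpret G: group comp_group by (rule group_comp_group)
  obtain a where a: "a \<in> proj_bcfs D" "A = sl2_class D a"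
    using assms(1) unfolding comp_group_simps sl2_classes_def by blast
  obtain q where q: "q \<in> proj_bcfs D" "lat_comp a a q" using lat_comp_exists[OF a(1) a(1)] .
  have "A \<otimes>\<^bsub>comp_group\<^esub> A \<otimes>\<^bsub>comp_group\<^esub> A = \<one>\<^bsub>comp_group\<^esub>"
    unfolding comp_group_simps
    using a q id_form_proj lat_comp_cube[of a q] by (simp add: comp_mult_classes)
  then have "A [^]\<^bsub>comp_group\<^esub> (3::nat) = \<one>\<^bsub>comp_group\<^esub>"
    using assms(1) by (simp add: numeral_3_eq_3)
  then have "G.ord A dvd 3" using G.pow_eq_id assms(1) by blast
  moreover from this have "G.ord A \<le> 3" by (simp add: dvd_imp_le)
  \<comment> \<open>The value 0 would mean infinite order; like 2, it does not divide 3.\<close>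
  then have "G.ord A \<in> {0, 1, 2, 3}" by auto
  ultimately have "G.ord A = 1 \<or> G.ord A = 3" by auto
  then show ?thesis using G.ord_eq_1 assms by blast
qed

end

theorem theorem1p1:
  fixes D :: int
  assumes nonzero: "D \<noteq> 0"
    and nonsquare: "\<not> (\<exists>k. D = k^2)"
    and mod4: "D mod 4 = 0 \<or> D mod 4 = 1"
  shows "(\<forall>p1 \<in> proj_bcfs D. \<forall>p2 \<in> proj_bcfs D.
            (\<exists>P. is_composition D p1 p2 P) \<and>
            (\<forall>P Q. is_composition D p1 p2 P \<longrightarrow> is_composition D p1 p2 Q \<longrightarrow> sl2_equiv P Q)) \<and>
         (\<exists>G :: int bcf set monoid.
            group G \<and>
            carrier G = sl2_classes D \<and>
            (\<forall>p1 \<in> proj_bcfs D. \<forall>p2 \<in> proj_bcfs D. \<forall>P. is_composition D p1 p2 P \<longrightarrow>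
               sl2_class D p1 \<otimes>\<^bsub>G\<^esub> sl2_class D p2 = sl2_class D P) \<and>
            (\<forall>A \<in> carrier G. A \<noteq> \<one>\<^bsub>G\<^esub> \<longrightarrow> group.ord G A = 3))"
proof -
  interpret quadratic_disc D by unfold_locales (fact nonsquare mod4)+
  have comp_proj: "P \<in> proj_bcfs D" if "is_composition D p1 p2 P" for p1 p2 P
    using that unfolding is_composition_def composed_via_def by blast
  have "sl2_equiv P Q"
    if "p1 \<in> proj_bcfs D" "p2 \<in> proj_bcfs D" "is_composition D p1 p2 P" "is_composition D p1 p2 Q" for p1 p2 P Q
  proof -
    have "bcf_disc p1 = D" "bcf_disc p2 = D" "bcf_disc P = D" "bcf_disc Q = D"
      using that comp_proj by (simp_all add: proj_bcfs_def)
    \<comment> \<open>The roles of \<open>P\<close> and \<open>Q\<close> are exchanged because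
      passing from lattices back to forms reverses the direction.\<close>
    then show ?thesis
      using lat_comp_unique[of p1 p2 Q P] is_composition_imp_lat_comp[OF that(1,2)] that(3,4)
        lat_equiv_imp_sl2_equiv by blast
  qed
  moreover have "sl2_class D p1 \<otimes>\<^bsub>comp_group\<^esub> sl2_class D p2 = sl2_class D P"
    if "p1 \<in> proj_bcfs D" "p2 \<in> proj_bcfs D" "is_composition D p1 p2 P" for p1 p2 P
    unfolding comp_group_simps
    using that comp_proj is_composition_imp_lat_comp by (intro comp_mult_classes) auto
  ultimately show ?thesis
    using composition_exists group_comp_group comp_group_simps(1) comp_group_ord by blast
qed

end
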